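(* Let $(W,S)$ be an irreducible Coxeter system with Coxeter number $h$. If $f:W\to W$ is compulsive, then \[\sup_{w\in W}\left|O_f(w)\right|\leq h.\]
   Context: For a Coxeter system $(W,S)$ with length function $\ell$, the right weak order is $x\leq_R y$ iff $\ell(x^{-1}y)=\ell(y)-\ell(x)$. The right descent set of $w$ is $D_R(w)=\{s\in S:\ell(ws)<\ell(w)\}$. A map $f:W\to W$ is compulsive if $f(w)\leq_R w$ and $f(w)\leq_R ws$ for every $w\in W$ and every $s\in D_R(w)$. The forward orbit of $w$ under $f$ is $O_f(w)=\{w,f(w),f^2(w),\ldots\}$. $W$ is irreducible if its Coxeter diagram is connected. For finite $W$, the Coxeter number $h$ is the order of a Coxeter element (a product of all simple generators in some order); for infinite $W$, $h=\infty$. *)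

theory Defs
  imports
    "HOL-Algebra.Multiplicative_Group"
    "HOL-Algebra.Generated_Groups"
    "HOL-Library.Extended_Nat"
begin

section \<open>Group presentations\<close>

text \<open>
  Words in the free group on \<open>S\<close> are lists of signed letters: \<open>(s, True)\<close> stands for \<open>s\<close> and
  \<open>(s, False)\<close> for its formal inverse.
\<close>

type_synonym 'a signed_word = "('a \<times> bool) list"

definition signed_words :: "'a set \<Rightarrow> 'a signed_word set" where
  "signed_words S = lists (S \<times> UNIV)"

inductive word_step :: "'a set \<Rightarrow> 'a signed_word set \<Rightarrow> 'a signed_word \<Rightarrow> 'a signed_word \<Rightarrow> bool"
  for S :: "'a set" and R :: "'a signed_word set" where
  cancel: "s \<in> S \<Longrightarrow> word_step S R (u @ [(s, b), (s, \<not> b)] @ v) (u @ v)"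
| relator: "r \<in> R \<Longrightarrow> word_step S R (u @ r @ v) (u @ v)"

definition eval_word :: "('a, 'b) monoid_scheme \<Rightarrow> 'a signed_word \<Rightarrow> 'a" where
  "eval_word G w =
     foldr (\<lambda>(s, b) x. (if b then s else inv\<^bsub>G\<^esub> s) \<otimes>\<^bsub>G\<^esub> x) w \<one>\<^bsub>G\<^esub>"

text \<open>
  \<open>G = \<langle>S | R\<rangle>\<close>. The equivalence closure of \<^const>\<open>word_step\<close> identifies two words exactly when they
  have the same class in the free group on \<open>S\<close> modulo the normal closure of \<open>R\<close>.
\<close>

definition has_presentation ::
    "('a, 'b) monoid_scheme \<Rightarrow> 'a set \<Rightarrow> 'a signed_word set \<Rightarrow> bool" where
  "has_presentation G S R \<longleftrightarrow>
     group G \<and> S \<subseteq> carrier G \<and> R \<subseteq> signed_words S \<and> generate G S = carrier G \<and>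
     (\<forall>u \<in> signed_words S. \<forall>v \<in> signed_words S.
        eval_word G u = eval_word G v \<longleftrightarrow> equivclp (word_step S R) u v)"

section \<open>Coxeter systems\<close>

definition coxeter_matrix :: "'a set \<Rightarrow> ('a \<Rightarrow> 'a \<Rightarrow> enat) \<Rightarrow> bool" where
  "coxeter_matrix S m \<longleftrightarrow>
     (\<forall>s \<in> S. \<forall>t \<in> S. m s t \<ge> 1 \<and> m s t = m t s \<and> (m s t = 1 \<longleftrightarrow> s = t))"

text \<open>
  The words \<open>(s t)^m(s,t)\<close> with \<open>m(s,t)\<close> finite; an infinite entry imposes no relation, and
  \<open>s = t\<close> gives \<open>s\<^sup>2\<close>.
\<close>

definition coxeter_relators :: "'a set \<Rightarrow> ('a \<Rightarrow> 'a \<Rightarrow> enat) \<Rightarrow> 'a signed_word set" where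
  "coxeter_relators S m =
     {concat (replicate k [(s, True), (t, True)]) | s t k. s \<in> S \<and> t \<in> S \<and> m s t = enat k}"

definition coxeter_system ::
    "('a, 'b) monoid_scheme \<Rightarrow> 'a set \<Rightarrow> ('a \<Rightarrow> 'a \<Rightarrow> enat) \<Rightarrow> bool" where
  "coxeter_system W S m \<longleftrightarrow>
     coxeter_matrix S m \<and> has_presentation W S (coxeter_relators S m)"

definition coxeter_diagram :: "'a set \<Rightarrow> ('a \<Rightarrow> 'a \<Rightarrow> enat) \<Rightarrow> ('a \<times> 'a) set" where
  "coxeter_diagram S m = {(s, t). s \<in> S \<and> t \<in> S \<and> s \<noteq> t \<and> m s t \<ge> 3}"

definition coxeter_irreducible :: "'a set \<Rightarrow> ('a \<Rightarrow> 'a \<Rightarrow> enat) \<Rightarrow> bool" where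
  "coxeter_irreducible S m \<longleftrightarrow> (\<forall>s \<in> S. \<forall>t \<in> S. (s, t) \<in> (coxeter_diagram S m)\<^sup>*)"

definition word_prod :: "('a, 'b) monoid_scheme \<Rightarrow> 'a list \<Rightarrow> 'a" where
  "word_prod W xs = foldr (\<otimes>\<^bsub>W\<^esub>) xs \<one>\<^bsub>W\<^esub>"

definition cox_length :: "('a, 'b) monoid_scheme \<Rightarrow> 'a set \<Rightarrow> 'a \<Rightarrow> nat" where
  "cox_length W S w = (LEAST n. \<exists>xs \<in> lists S. length xs = n \<and> word_prod W xs = w)"

text \<open>The difference of lengths is taken in the integers, as it would truncate at 0 in \<^typ>\<open>nat\<close>.\<close>

definition right_weak_le ::
    "('a, 'b) monoid_scheme \<Rightarrow> 'a set \<Rightarrow> 'a \<Rightarrow> 'a \<Rightarrow> bool" where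
  "right_weak_le W S x y \<longleftrightarrow>
     int (cox_length W S (inv\<^bsub>W\<^esub> x \<otimes>\<^bsub>W\<^esub> y)) = int (cox_length W S y) - int (cox_length W S x)"

definition right_descents :: "('a, 'b) monoid_scheme \<Rightarrow> 'a set \<Rightarrow> 'a \<Rightarrow> 'a set" where
  "right_descents W S w = {s \<in> S. cox_length W S (w \<otimes>\<^bsub>W\<^esub> s) < cox_length W S w}"

definition coxeter_element :: "('a, 'b) monoid_scheme \<Rightarrow> 'a set \<Rightarrow> 'a \<Rightarrow> bool" where
  "coxeter_element W S c \<longleftrightarrow> (\<exists>xs. distinct xs \<and> set xs = S \<and> c = word_prod W xs)"

text \<open>
  A relation rather than a function, since it is a theorem (all Coxeter elements of a finite Coxeter
  group are conjugate) that the order does not depend on the Coxeter element.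
\<close>

definition is_coxeter_number :: "('a, 'b) monoid_scheme \<Rightarrow> 'a set \<Rightarrow> enat \<Rightarrow> bool" where
  "is_coxeter_number W S h \<longleftrightarrow>
     (if finite (carrier W) then \<exists>c. coxeter_element W S c \<and> h = enat (group.ord W c)
      else h = \<infinity>)"

section \<open>Compulsive maps\<close>

text \<open>
  The condition \<open>f w \<le> w\<close> is required for every \<open>w\<close>, including the identity, which has no descents.
\<close>

definition compulsive :: "('a, 'b) monoid_scheme \<Rightarrow> 'a set \<Rightarrow> ('a \<Rightarrow> 'a) \<Rightarrow> bool" where
  "compulsive W S f \<longleftrightarrow>
     f \<in> carrier W \<rightarrow> carrier W \<and>
     (\<forall>w \<in> carrier W. right_weak_le W S (f w) w \<and>
        (\<forall>s \<in> right_descents W S w. right_weak_le W S (f w) (w \<otimes>\<^bsub>W\<^esub> s)))"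

definition forward_orbit :: "('a \<Rightarrow> 'a) \<Rightarrow> 'a \<Rightarrow> 'a set" where
  "forward_orbit f w = {(f ^^ n) w | n. True}"

definition ecard :: "'a set \<Rightarrow> enat" where
  "ecard A = (if finite A then enat (card A) else \<infinity>)"

end

theory Submission
  imports Defs "HOL-Analysis.Function_Topology" "HOL-Library.Sublist"
begin

text \<open>
  Only finite \<open>W\<close> needs an argument. The Coxeter diagram is then a tree, so every Coxeter element is
  conjugate to a bipartite one \<open>P M\<close>, where \<open>P\<close> and \<open>M\<close> are products of commuting generators. In the
  plane spanned by the two halves of the Perron--Frobenius vector, \<open>P\<close> and \<open>M\<close> act as reflections,
  and \<open>P M P \<dots>\<close> with at most \<open>h\<close> factors sends the fundamental chamber to its antipode, i.e. equals
  the longest element; so does \<open>M P M \<dots>\<close>. Hence every \<open>w\<close> is a product of a subword of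
  each of these two words with \<open>h\<close> factors. By the lifting property of the Bruhat order, one
  application of a compulsive map strips the last factor off the word. After \<open>h - 1\<close> steps the element
  is a product of a subword of \<open>P\<close> and also of a subword of \<open>M\<close>, hence trivial.
\<close>

section \<open>Reflections in coordinates\<close>

text \<open>\<open>is_coxeter_number\<close> accepts the order of any Coxeter element, so the bound
  has to hold for an arbitrary one. The conjugation to \<open>P M\<close> is carried out on linear
  maps, where all that must survive is that the \<open>h\<close>-th power is the identity. On the
  plane this gives the inequality \<open>pi \<le> h * \<theta>\<close>, the direction that bounds
  the number of factors by \<open>h\<close>. Finiteness enters the geometry through one averaging
  argument, which yields both that the diagram is a forest and that the Perron eigenvalue is below
  2, so that it can be written \<open>2 * cos \<theta>\<close> with a positive angle. Questions
  about the group are settled by the signs of the coordinates of the images of simple roots. Two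
  words are needed because stripping all \<open>h\<close> factors would take \<open>h\<close> steps
  and allow \<open>h + 1\<close> elements in the orbit; after \<open>h - 1\<close> steps one factor
  is left, and comparing what is left of the words beginning with \<open>P\<close> and with
  \<open>M\<close> saves the last step.\<close>

definition unit_vec :: "'a \<Rightarrow> 'a \<Rightarrow> real" where
  "unit_vec s = (\<lambda>r. of_bool (r = s))"

lemma sin_recurrence:
  "sin (real (n + 2) * \<theta>) = 2 * cos \<theta> * sin (real (n + 1) * \<theta>) - sin (real n * \<theta>)"
proof -
  have e: "real (n + 2) * \<theta> = real (n + 1) * \<theta> + \<theta>" "real n * \<theta> = real (n + 1) * \<theta> - \<theta>"
    by (simp_all add: algebra_simps)
  show ?thesis
    unfolding e(1) e(2) sin_add sin_diff by (simp add: algebra_simps)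
qed

locale reflections =
  fixes S :: "'a set" and a :: "'a \<Rightarrow> 'a \<Rightarrow> real"
  assumes finite_S: "finite S"
    and a_sym: "s \<in> S \<Longrightarrow> t \<in> S \<Longrightarrow> a s t = a t s"
    and a_nonneg: "s \<in> S \<Longrightarrow> t \<in> S \<Longrightarrow> s \<noteq> t \<Longrightarrow> 0 \<le> a s t"
begin

text \<open>
  The reflection in the simple root \<open>s\<close>, written in the basis of simple roots, for the form with
  \<open>B(s, s) = 1\<close> and \<open>B(s, t) = - a s t / 2\<close>.
\<close>

definition reflect :: "'a \<Rightarrow> ('a \<Rightarrow> real) \<Rightarrow> 'a \<Rightarrow> real" where
  "reflect s v = v(s := (\<Sum>t\<in>S - {s}. a s t * v t) - v s)"

definition act :: "'a list \<Rightarrow> ('a \<Rightarrow> real) \<Rightarrow> 'a \<Rightarrow> real" where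
  "act xs = foldr reflect xs"

text \<open>Vectors are total functions on the type; this predicate singles out the combinations of
  simple roots in \<open>S\<close>.\<close>

definition supported :: "('a \<Rightarrow> real) \<Rightarrow> bool" where
  "supported v \<longleftrightarrow> (\<forall>r. r \<notin> S \<longrightarrow> v r = 0)"

lemma act_Nil [simp]: "act [] v = v"
  and act_Cons [simp]: "act (x # xs) v = reflect x (act xs v)"
  and act_append [simp]: "act (xs @ ys) v = act xs (act ys v)"
  by (simp_all add: act_def)

lemma reflect_lincomb:
  "reflect s (\<lambda>r. p * u r + q * v r) = (\<lambda>r. p * reflect s u r + q * reflect s v r)"
  by (rule ext) (simp add: reflect_def sum.distrib sum_distrib_left algebra_simps)

lemma act_lincomb:
  "act xs (\<lambda>r. p * u r + q * v r) = (\<lambda>r. p * act xs u r + q * act xs v r)"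
  by (induction xs) (simp_all add: reflect_lincomb)

lemma act_scale: "act xs (\<lambda>r. p * u r) = (\<lambda>r. p * act xs u r)"
  using act_lincomb[of xs p u 0 u] by simp

lemma act_zero [simp]: "act xs (\<lambda>r. 0) = (\<lambda>r. 0)"
  using act_scale[of xs 0 "\<lambda>r. 0"] by simp

lemma act_sum:
  assumes "finite I"
  shows "act xs (\<lambda>r. \<Sum>i\<in>I. p i * u i r) = (\<lambda>r. \<Sum>i\<in>I. p i * act xs (u i) r)"
  using assms
proof (induction I rule: finite_induct)
  case (insert i I)
  then show ?case
    using act_lincomb[of xs "p i" "u i" 1 "\<lambda>r. \<Sum>i\<in>I. p i * u i r"] by simp
qed simp

lemma supported_unit_vec: "s \<in> S \<Longrightarrow> supported (unit_vec s)"
  by (auto simp: supported_def unit_vec_def)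

lemma unit_vec_self [simp]: "unit_vec s s = 1"
  and unit_vec_other: "r \<noteq> s \<Longrightarrow> unit_vec s r = 0"
  and unit_vec_nonneg: "0 \<le> unit_vec s r"
  by (simp_all add: unit_vec_def)

lemma supported_act: "xs \<in> lists S \<Longrightarrow> supported v \<Longrightarrow> supported (act xs v)"
  by (induction xs) (auto simp: supported_def reflect_def)

lemma supported_expand:
  assumes "supported v"
  shows "v = (\<lambda>r. \<Sum>s\<in>S. v s * unit_vec s r)"
proof
  fix r
  show "v r = (\<Sum>s\<in>S. v s * unit_vec s r)"
  proof (cases "r \<in> S")
    case True
    then have "(\<Sum>s\<in>S. v s * unit_vec s r) = (\<Sum>s\<in>{r}. v s * unit_vec s r)"
      using finite_S by (intro sum.mono_neutral_right) (auto simp: unit_vec_def)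
    then show ?thesis by simp
  next
    case False
    then have "(\<Sum>s\<in>S. v s * unit_vec s r) = 0"
      by (intro sum.neutral) (auto simp: unit_vec_def)
    then show ?thesis using False assms by (simp add: supported_def)
  qed
qed

lemma act_expand:
  assumes "supported v"
  shows "act xs v r = (\<Sum>s\<in>S. v s * act xs (unit_vec s) r)"
  by (subst supported_expand[OF assms], subst act_sum[OF finite_S]) simp

lemma reflect_involution [simp]: "reflect s (reflect s v) = v"
proof -
  have "(\<Sum>t\<in>S - {s}. a s t * reflect s v t) = (\<Sum>t\<in>S - {s}. a s t * v t)"
    by (intro sum.cong) (auto simp: reflect_def)
  then show ?thesis
    by (simp add: reflect_def fun_eq_iff)
qed

lemma act_rev [simp]: "act (rev xs) (act xs v) = v" "act xs (act (rev xs) v) = v"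
proof -
  show *: "act (rev xs) (act xs v) = v" for xs
    by (induction xs arbitrary: v) simp_all
  show "act xs (act (rev xs) v) = v"
    using *[of "rev xs"] by simp
qed

lemma reflect_unit_vec_self: "reflect s (unit_vec s) = (\<lambda>r. - unit_vec s r)"
proof -
  have "(\<Sum>t\<in>S - {s}. a s t * unit_vec s t) = 0"
    by (intro sum.neutral) (auto simp: unit_vec_def)
  then show ?thesis
    by (auto simp: reflect_def unit_vec_def)
qed

lemma reflect_unit_vec:
  assumes "s \<in> S" "s \<noteq> t"
  shows "reflect t (unit_vec s) = (\<lambda>r. unit_vec s r + a t s * unit_vec t r)"
proof -
  have "(\<Sum>r\<in>S - {t}. a t r * unit_vec s r) = (\<Sum>r\<in>{s}. a t r * unit_vec s r)"
    using assms finite_S by (intro sum.mono_neutral_right) (auto simp: unit_vec_def)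
  then show ?thesis
    using assms by (auto simp: reflect_def unit_vec_def)
qed

lemma sum_split_pair:
  assumes "s \<in> S" "t \<in> S" "s \<noteq> t"
  shows "(\<Sum>r\<in>S - {s}. a s r * (v(s := x, t := y)) r) = a s t * y + (\<Sum>r\<in>S - {s, t}. a s r * v r)"
proof -
  have "S - {s} = insert t (S - {s, t})"
    using assms by auto
  then have "(\<Sum>r\<in>S - {s}. a s r * (v(s := x, t := y)) r)
      = a s t * y + (\<Sum>r\<in>S - {s, t}. a s r * (v(s := x, t := y)) r)"
    using finite_S by simp
  also have "(\<Sum>r\<in>S - {s, t}. a s r * (v(s := x, t := y)) r) = (\<Sum>r\<in>S - {s, t}. a s r * v r)"
    by (intro sum.cong) auto
  finally show ?thesis .
qed

text \<open>
  On the two coordinates \<open>s\<close> and \<open>t\<close> the product of the reflections is affine with a fixed point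
  \<open>(x0, y0)\<close>; the deviations from it obey the recurrence of \<open>n \<mapsto> sin (n \<theta>)\<close>.
\<close>

lemma act_dihedral_relation:
  assumes st: "s \<in> S" "t \<in> S" "s \<noteq> t" and k: "2 \<le> k" and a: "a s t = 2 * cos (pi / real k)"
  shows "act (concat (replicate k [s, t])) v = v"
proof -
  define \<theta> where "\<theta> = pi / real k"
  have th: "0 < \<theta>" "\<theta> < pi" and kth: "real k * \<theta> = pi"
    using k by (simp_all add: \<theta>_def field_simps)
  have sin: "0 < sin \<theta>" using th by (rule sin_gt_zero)
  define c where "c = 2 * cos \<theta>"
  have ac: "a s t = c" "a t s = c" using a a_sym[of s t] st by (simp_all add: c_def \<theta>_def)
  have "4 - c\<^sup>2 = 4 * (sin \<theta>)\<^sup>2"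
    unfolding c_def power_mult_distrib sin_squared_eq by simp
  then have det: "4 - c\<^sup>2 \<noteq> 0" using sin by simp
  define e where "e = (\<Sum>r\<in>S - {s, t}. a s r * v r)"
  define f where "f = (\<Sum>r\<in>S - {s, t}. a t r * v r)"
  define x0 where "x0 = (2 * e + c * f) / (4 - c\<^sup>2)"
  define y0 where "y0 = (2 * f + c * e) / (4 - c\<^sup>2)"
  have fp: "2 * x0 = c * y0 + e" "2 * y0 = c * x0 + f"
    using det by (simp_all add: x0_def y0_def field_simps power2_eq_square)
  \<comment> \<open>The solution of the recurrence that starts with the deviations of
    \<open>t\<close> and \<open>s\<close>. Even indices follow coordinate \<open>t\<close>, which is
    reflected first, and odd ones \<open>s\<close>; after \<open>k\<close> rounds the angle has
    grown by \<open>2 * k * \<theta> = 2 * pi\<close>.\<close>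
  define z where "z n = ((v s - x0) * sin (real n * \<theta>) - (v t - y0) * sin (real n * \<theta> - \<theta>)) / sin \<theta>"
    for n :: nat
  have z: "z (n + 2) = c * z (n + 1) - z n" for n
  proof -
    have "sin (real (n + 2) * \<theta> - \<theta>) = c * sin (real (n + 1) * \<theta> - \<theta>) - sin (real n * \<theta> - \<theta>)"
    proof -
      have e: "real (n + 2) * \<theta> - \<theta> = real n * \<theta> + \<theta>" "real (n + 1) * \<theta> - \<theta> = real n * \<theta>"
        by (simp_all add: algebra_simps)
      show ?thesis unfolding e sin_add sin_diff by (simp add: c_def algebra_simps)
    qed
    then show ?thesis
      unfolding z_def sin_recurrence c_def[symmetric]
      by (simp only:) (simp add: diff_divide_distrib add_divide_distrib algebra_simps)
  qed
  have z01: "z 0 = v t - y0" "z 1 = v s - x0"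
    using sin by (simp_all add: z_def)
  have red: "reflect s (v(s := x, t := y)) = v(s := c * y + e - x, t := y)"
    "reflect t (v(s := x, t := y)) = v(s := x, t := c * x + f - y)" for x y
  proof -
    show "reflect s (v(s := x, t := y)) = v(s := c * y + e - x, t := y)"
      using sum_split_pair[OF st, of v x y] st(3) by (auto simp: reflect_def ac e_def)
    have "v(s := x, t := y) = v(t := y, s := x)"
      using st(3) by (simp add: fun_upd_twist)
    then show "reflect t (v(s := x, t := y)) = v(s := x, t := c * x + f - y)"
      using sum_split_pair[OF st(2,1) st(3)[symmetric], of v y x] st(3)
      by (auto simp: reflect_def ac f_def insert_commute)
  qed
  have "act (concat (replicate n [s, t])) v = v(s := x0 + z (2 * n + 1), t := y0 + z (2 * n))" for n
  proof (induction n)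
    case 0
    then show ?case using z01 by simp
  next
    case (Suc n)
    have 1: "c * (x0 + z (2 * n + 1)) + f - (y0 + z (2 * n)) = y0 + z (2 * n + 2)"
      using z[of "2 * n"] fp by (simp add: algebra_simps)
    have 2: "c * (y0 + z (2 * n + 2)) + e - (x0 + z (2 * n + 1)) = x0 + z (2 * n + 3)"
      using z[of "2 * n + 1"] fp by (simp add: algebra_simps eval_nat_numeral)
    have "act (concat (replicate (Suc n) [s, t])) v
        = reflect s (reflect t (v(s := x0 + z (2 * n + 1), t := y0 + z (2 * n))))"
      by (simp only: replicate_Suc concat.simps act_append Suc act_Cons act_Nil)
    also have "\<dots> = v(s := x0 + z (2 * n + 3), t := y0 + z (2 * n + 2))"
      by (simp only: red 1 2)
    finally show ?case by (simp add: eval_nat_numeral fun_upd_def)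
  qed
  moreover have "z (2 * k) = z 0" "z (2 * k + 1) = z 1"
  proof -
    have e: "real (2 * k) * \<theta> = 2 * pi" "real (2 * k + 1) * \<theta> = \<theta> + 2 * pi"
      using kth by (simp_all add: algebra_simps)
    have "sin (2 * pi - \<theta>) = - sin \<theta>" by (simp add: sin_diff)
    then show "z (2 * k) = z 0" "z (2 * k + 1) = z 1"
      unfolding z_def e by simp_all
  qed
  ultimately show ?thesis using z01 by simp
qed

lemma reflect_commute:
  assumes "s \<in> S" "t \<in> S" "s \<noteq> t" "a s t = 0"
  shows "reflect s (reflect t v) = reflect t (reflect s v)"
proof -
  have "a t s = 0" using a_sym assms by simp
  have "(\<Sum>r\<in>S - {s}. a s r * reflect t v r) = (\<Sum>r\<in>S - {s}. a s r * v r)"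
    using assms by (intro sum.cong) (auto simp: reflect_def)
  moreover have "(\<Sum>r\<in>S - {t}. a t r * reflect s v r) = (\<Sum>r\<in>S - {t}. a t r * v r)"
    using assms \<open>a t s = 0\<close> by (intro sum.cong) (auto simp: reflect_def)
  ultimately show ?thesis
    using assms by (simp add: reflect_def fun_upd_twist)
qed

text \<open>The last letter is the distinguished one: it acts first on vectors, and in the
  positivity proof it is the known descent.\<close>

fun alt :: "nat \<Rightarrow> 'a \<Rightarrow> 'a \<Rightarrow> 'a list" where
  "alt 0 s t = []"
| "alt (Suc n) s t = alt n t s @ [t]"

lemma length_alt [simp]: "length (alt n s t) = n"
  by (induction n s t rule: alt.induct) simp_all

lemma set_alt: "set (alt n s t) \<subseteq> {s, t}"
  by (induction n s t rule: alt.induct) auto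

lemma alt_add: "\<exists>us \<in> lists {s, t}. length us = i \<and> alt (i + n) s t = us @ alt n s t"
proof (induction n arbitrary: s t)
  case 0
  show ?case using set_alt[of i s t] by (intro bexI[of _ "alt i s t"]) auto
next
  case (Suc n)
  from Suc[of t s] show ?case by (auto simp: insert_commute)
qed

lemma alt_double: "alt (2 * k) s t = concat (replicate k [s, t])"
proof (induction k)
  case (Suc k)
  have "alt (2 * Suc k) s t = alt (2 * k) s t @ [s, t]" by simp
  also have "\<dots> = concat (replicate k [s, t] @ [[s, t]])"
    using Suc by simp
  also have "\<dots> = concat (replicate (Suc k) [s, t])"
    by (simp only: replicate_append_same replicate_Suc)
  finally show ?case .
qed simp

lemma distinct_adj_eq_alt:
  assumes "zs \<in> lists {s, t}" "distinct_adj zs" "zs \<noteq> [] \<Longrightarrow> last zs = t" "s \<noteq> t"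
  shows "zs = alt (length zs) s t"
  using assms
proof (induction zs arbitrary: s t rule: rev_induct)
  case (snoc z zs)
  then have "z = t" by simp
  have "zs = alt (length zs) t s"
  proof (rule snoc.IH)
    show "zs \<in> lists {t, s}" "distinct_adj zs" "t \<noteq> s"
      using snoc.prems by (auto simp: distinct_adj_append_iff)
    show "last zs = s" if "zs \<noteq> []"
      using that snoc.prems \<open>z = t\<close> by (auto simp: distinct_adj_append_iff) 
  qed
  then show ?case using \<open>z = t\<close> by simp
qed simp

text \<open>Reflecting \<open>x (i + 1) s + x i t\<close> in \<open>t\<close> replaces
  \<open>x i\<close> by \<open>x (i + 2)\<close>, so each letter shifts the index by one. The
  unordered pair \<open>{p, q}\<close> hides the parity of \<open>n\<close>.\<close>

lemma act_alt:
  assumes "s \<in> S" "t \<in> S" "s \<noteq> t"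
    and rec: "\<And>i. x (i + 2) = a s t * x (i + 1) - x i"
  shows "\<exists>p q. {p, q} = {s, t} \<and>
    act (alt n s t) (\<lambda>r. x (i + 1) * unit_vec s r + x i * unit_vec t r)
      = (\<lambda>r. x (i + n + 1) * unit_vec p r + x (i + n) * unit_vec q r)"
  using assms
proof (induction n arbitrary: s t i)
  case 0
  then show ?case by auto
next
  case (Suc n)
  have "reflect t (\<lambda>r. x (i + 1) * unit_vec s r + x i * unit_vec t r)
      = (\<lambda>r. x (i + 2) * unit_vec t r + x (i + 1) * unit_vec s r)"
    unfolding reflect_lincomb reflect_unit_vec[OF Suc.prems(1,3)] reflect_unit_vec_self
      a_sym[OF Suc.prems(2,1)] Suc.prems(4)[of i]
    by (simp add: algebra_simps)
  moreover obtain p q where "{p, q} = {t, s}"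
    "act (alt n t s) (\<lambda>r. x (Suc i + 1) * unit_vec t r + x (Suc i) * unit_vec s r)
      = (\<lambda>r. x (Suc i + n + 1) * unit_vec p r + x (Suc i + n) * unit_vec q r)"
    using Suc.IH[of t s "Suc i"] Suc.prems a_sym[of s t] by auto
  ultimately show ?case by (intro exI[of _ p] exI[of _ q]) (auto simp: insert_commute)
qed

end

section \<open>The geometric representation of a Coxeter group\<close>

text \<open>This is \<open>-2 B(s, t)\<close> for the Tits form
  \<open>B(s, t) = - cos (pi / m s t)\<close>; an infinite bond takes the limiting value 1 of the
  cosine.\<close>

definition bond :: "('a \<Rightarrow> 'a \<Rightarrow> enat) \<Rightarrow> 'a \<Rightarrow> 'a \<Rightarrow> real" where
  "bond m s t = (case m s t of enat k \<Rightarrow> 2 * cos (pi / real k) | \<infinity> \<Rightarrow> 2)"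

lemma not_distinct_adj_decomp:
  "\<not> distinct_adj xs \<Longrightarrow> \<exists>ps x qs. xs = ps @ [x, x] @ qs"
proof (induction xs)
  case (Cons y ys)
  show ?case
  proof (cases "distinct_adj ys")
    case True
    with Cons.prems obtain zs where "ys = y # zs"
      by (cases ys) auto
    then show ?thesis by (intro exI[of _ "[]"]) auto
  next
    case False
    then show ?thesis using Cons.IH by (metis append_Cons)
  qed
qed simp

locale finite_rank_coxeter =
  fixes W :: "('a, 'b) monoid_scheme" (structure) and S :: "'a set" and m :: "'a \<Rightarrow> 'a \<Rightarrow> enat"
  assumes system: "coxeter_system W S m" and finite_gens: "finite S"
begin

declare in_lists_conv_set [simp]

lemma m_sym: "s \<in> S \<Longrightarrow> t \<in> S \<Longrightarrow> m s t = m t s"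
  and m_ge_1: "s \<in> S \<Longrightarrow> t \<in> S \<Longrightarrow> 1 \<le> m s t"
  and m_eq_1_iff: "s \<in> S \<Longrightarrow> t \<in> S \<Longrightarrow> m s t = 1 \<longleftrightarrow> s = t"
  using system by (auto simp: coxeter_system_def coxeter_matrix_def)

lemma m_ge_2:
  assumes "s \<in> S" "t \<in> S" "s \<noteq> t" "m s t = enat k"
  shows "2 \<le> k"
  using m_ge_1[OF assms(1,2)] m_eq_1_iff[OF assms(1,2)] assms(3,4) by (auto simp: one_enat_def)

sublocale reflections S "bond m"
proof
  fix s t assume st: "s \<in> S" "t \<in> S"
  show "bond m s t = bond m t s"
    using m_sym[OF st] by (simp add: bond_def)
  assume "s \<noteq> t"
  show "0 \<le> bond m s t"
  proof (cases "m s t")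
    case (enat k)
    have "pi / real k \<le> pi / 2"
      using m_ge_2[OF st \<open>s \<noteq> t\<close> enat] by (intro divide_left_mono) auto
    moreover have "- (pi / 2) \<le> pi / real k"
      by (rule order.trans[of _ 0]) auto
    ultimately have "0 \<le> cos (pi / real k)"
      by (intro cos_ge_zero)
    then show ?thesis
      using enat by (simp add: bond_def)
  qed (simp add: bond_def)
qed (rule finite_gens)

sublocale group W
  using system by (simp add: coxeter_system_def has_presentation_def)

lemma gens_carrier: "S \<subseteq> carrier W"
  and gens_generate: "generate W S = carrier W"
  using system by (simp_all add: coxeter_system_def has_presentation_def)

lemma eval_word_eq_iff:
  "u \<in> signed_words S \<Longrightarrow> v \<in> signed_words S \<Longrightarrow>
    eval_word W u = eval_word W v \<longleftrightarrow> equivclp (word_step S (coxeter_relators S m)) u v"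
  using system unfolding coxeter_system_def has_presentation_def by blast

lemma gen_carrier [simp]: "s \<in> S \<Longrightarrow> s \<in> carrier W"
  using gens_carrier by auto

section \<open>Words in the generators and their action\<close>

lemma word_prod_Nil [simp]: "word_prod W [] = \<one>"
  and word_prod_Cons [simp]: "word_prod W (x # xs) = x \<otimes> word_prod W xs"
  by (simp_all add: word_prod_def)

lemma word_prod_closed [simp]: "xs \<in> lists S \<Longrightarrow> word_prod W xs \<in> carrier W"
  by (induction xs) auto

lemma word_prod_append [simp]:
  "xs \<in> lists S \<Longrightarrow> ys \<in> lists S \<Longrightarrow> word_prod W (xs @ ys) = word_prod W xs \<otimes> word_prod W ys"
  by (induction xs) (auto simp: m_assoc)

lemma eval_word_positive: "eval_word W (map (\<lambda>s. (s, True)) xs) = word_prod W xs"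
  by (simp add: eval_word_def word_prod_def foldr_map comp_def)

lemma signed_words_positive: "xs \<in> lists S \<Longrightarrow> map (\<lambda>s. (s, True)) xs \<in> signed_words S"
  by (auto simp: signed_words_def)

lemma word_prod_relator:
  assumes "s \<in> S" "t \<in> S" "m s t = enat k"
  shows "word_prod W (concat (replicate k [s, t])) = \<one>"
proof -
  let ?r = "concat (replicate k [(s, True), (t, True)])"
  have map: "map (\<lambda>s. (s, True)) (concat (replicate k [s, t])) = ?r"
    by (simp add: map_concat)
  have "?r \<in> coxeter_relators S m"
    using assms by (auto simp: coxeter_relators_def)
  then have "word_step S (coxeter_relators S m) ?r []"
    using word_step.relator[of ?r _ S "[]" "[]"] by simp
  moreover have "?r \<in> signed_words S" "[] \<in> signed_words S"
    using assms by (auto simp: signed_words_def split: if_splits)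
  ultimately have "eval_word W ?r = eval_word W []"
    by (simp add: eval_word_eq_iff r_into_equivclp)
  then show ?thesis
    using eval_word_positive[of "concat (replicate k [s, t])"] eval_word_positive[of "[]"]
    by (simp add: map)
qed

lemma gen_square [simp]: "s \<in> S \<Longrightarrow> s \<otimes> s = \<one>"
  using word_prod_relator[of s s 1] m_eq_1_iff[of s s] by (simp add: one_enat_def)

lemma gen_inv [simp]: "s \<in> S \<Longrightarrow> inv s = s"
  by (simp add: inv_equality)

lemma mult_gen_gen [simp]: "s \<in> S \<Longrightarrow> w \<in> carrier W \<Longrightarrow> w \<otimes> s \<otimes> s = w"
  by (simp add: m_assoc)

lemma gen_gen_mult [simp]: "s \<in> S \<Longrightarrow> w \<in> carrier W \<Longrightarrow> s \<otimes> (s \<otimes> w) = w"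
  by (simp flip: m_assoc)

text \<open>Reflections are involutions, so \<open>map fst\<close> may drop the sign of a letter; a
  relator acts trivially by the dihedral computation.\<close>

lemma act_word_step:
  "word_step S (coxeter_relators S m) u v \<Longrightarrow> act (map fst u) = act (map fst v)"
proof (induction rule: word_step.induct)
  case (cancel s u b v)
  then show ?case by (simp add: fun_eq_iff)
next
  case (relator r u v)
  then obtain s t k where r: "s \<in> S" "t \<in> S" "m s t = enat k"
    "r = concat (replicate k [(s, True), (t, True)])"
    by (auto simp: coxeter_relators_def)
  then have r': "map fst r = concat (replicate k [s, t])"
    by (simp add: map_concat)
  have "act (concat (replicate k [s, t])) x = x" for x
  proof (cases "s = t")
    case True
    then have "k = 1" using m_eq_1_iff[of s t] r by (simp add: one_enat_def)
    then show ?thesis using True by simp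
  next
    case False
    then show ?thesis
      using r m_ge_2[of s t k] by (intro act_dihedral_relation) (auto simp: bond_def)
  qed
  then show ?case by (intro ext) (simp add: r')
qed

lemma act_equivclp:
  "equivclp (word_step S (coxeter_relators S m)) u v \<Longrightarrow> act (map fst u) = act (map fst v)"
  by (induction rule: equivclp_induct) (auto dest: act_word_step)

text \<open>By the presentation, equal products are linked by word steps; hence the action factors
  through the group, and \<open>rep\<close> below does not depend on the chosen word.\<close>

lemma act_eq_if_word_prod_eq:
  assumes "xs \<in> lists S" "ys \<in> lists S" "word_prod W xs = word_prod W ys"
  shows "act xs = act ys"
proof -
  have "act (map fst (map (\<lambda>s. (s, True)) xs)) = act (map fst (map (\<lambda>s. (s, True)) ys))"
    by (rule act_equivclp, subst eval_word_eq_iff[symmetric])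
      (use assms in \<open>simp_all add: signed_words_positive eval_word_positive\<close>)
  then show ?thesis by (simp add: comp_def)
qed

lemma inv_word_prod:
  "xs \<in> lists S \<Longrightarrow> inv (word_prod W xs) = word_prod W (rev xs)"
  by (induction xs) (auto simp: inv_mult_group)

lemma ex_word:
  assumes "w \<in> carrier W"
  shows "\<exists>xs \<in> lists S. word_prod W xs = w"
proof -
  have "w \<in> generate W S" using assms gens_generate by simp
  then show ?thesis
  proof (induction rule: generate.induct)
    case one
    then show ?case by (intro bexI[of _ "[]"]) auto
  next
    case (incl s)
    then show ?case by (intro bexI[of _ "[s]"]) auto
  next
    case (inv s)
    then show ?case by (intro bexI[of _ "[s]"]) auto
  next
    case (eng x y)
    then obtain xs ys where "xs \<in> lists S" "ys \<in> lists S" "word_prod W xs = x" "word_prod W ys = y"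
      by auto
    then show ?case by (intro bexI[of _ "xs @ ys"]) auto
  qed
qed

section \<open>The length function\<close>

abbreviation len :: "'a \<Rightarrow> nat" where "len \<equiv> cox_length W S"

lemma len_word_prod_le: "xs \<in> lists S \<Longrightarrow> len (word_prod W xs) \<le> length xs"
  unfolding cox_length_def by (rule Least_le) auto

lemma ex_reduced_word:
  assumes "w \<in> carrier W"
  shows "\<exists>xs \<in> lists S. length xs = len w \<and> word_prod W xs = w"
  unfolding cox_length_def
  by (rule LeastI_ex) (use ex_word[OF assms] in auto)

lemma len_mult_le:
  assumes "x \<in> carrier W" "y \<in> carrier W"
  shows "len (x \<otimes> y) \<le> len x + len y"
proof -
  obtain xs ys where "xs \<in> lists S" "length xs = len x" "word_prod W xs = x"
    "ys \<in> lists S" "length ys = len y" "word_prod W ys = y"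
    using ex_reduced_word assms by meson
  then show ?thesis using len_word_prod_le[of "xs @ ys"] by auto
qed

lemma len_one [simp]: "len \<one> = 0"
  using len_word_prod_le[of "[]"] by simp

lemma len_gen_le: "s \<in> S \<Longrightarrow> len s \<le> 1"
  using len_word_prod_le[of "[s]"] by simp

lemma len_eq_0: "w \<in> carrier W \<Longrightarrow> len w = 0 \<Longrightarrow> w = \<one>"
  using ex_reduced_word[of w] by auto

lemma len_mult_gen_le: "w \<in> carrier W \<Longrightarrow> s \<in> S \<Longrightarrow> len (w \<otimes> s) \<le> len w + 1"
  using len_mult_le[of w s] len_gen_le[of s] by simp

lemma len_le_mult_gen: "w \<in> carrier W \<Longrightarrow> s \<in> S \<Longrightarrow> len w \<le> len (w \<otimes> s) + 1"
  using len_mult_gen_le[of "w \<otimes> s" s] by simp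

lemma reduced_distinct_adj:
  assumes "xs \<in> lists S" "length xs \<le> len (word_prod W xs)"
  shows "distinct_adj xs"
proof (rule ccontr)
  assume "\<not> distinct_adj xs"
  then obtain ps x qs where xs: "xs = ps @ [x, x] @ qs"
    using not_distinct_adj_decomp by blast
  then have "word_prod W xs = word_prod W (ps @ qs)"
    using assms(1) by simp
  then show False
    using len_word_prod_le[of "ps @ qs"] assms xs by simp
qed

lemma ex_descent:
  assumes "w \<in> carrier W" "w \<noteq> \<one>"
  shows "\<exists>t\<in>S. len (w \<otimes> t) < len w"
proof -
  obtain xs where xs: "xs \<in> lists S" "length xs = len w" "word_prod W xs = w"
    using ex_reduced_word[OF assms(1)] by auto
  then have "xs \<noteq> []" using assms(2) by auto
  then obtain ys t where xs_eq: "xs = ys @ [t]" by (metis rev_exhaust)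
  then have t: "t \<in> S" and ys: "ys \<in> lists S" using xs(1) by auto
  have "w \<otimes> t = word_prod W ys"
    using xs(3) xs_eq t ys by auto
  then show ?thesis
    using len_word_prod_le[OF ys] xs(2) xs_eq t by (intro bexI[of _ t]) auto
qed

section \<open>The representation on group elements and positivity of roots\<close>

definition rep :: "'a \<Rightarrow> ('a \<Rightarrow> real) \<Rightarrow> 'a \<Rightarrow> real" where
  "rep w = act (SOME xs. xs \<in> lists S \<and> word_prod W xs = w)"

lemma rep_word_prod: "xs \<in> lists S \<Longrightarrow> rep (word_prod W xs) = act xs"
  unfolding rep_def by (rule someI2[of _ xs]) (auto intro: act_eq_if_word_prod_eq)

lemma rep_cases:
  assumes "w \<in> carrier W"
  obtains xs where "xs \<in> lists S" "word_prod W xs = w" "rep w = act xs"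
  using ex_word[OF assms] rep_word_prod by auto

lemma rep_one [simp]: "rep \<one> v = v"
  using rep_word_prod[of "[]"] by simp

lemma rep_gen: "s \<in> S \<Longrightarrow> rep s = reflect s"
  using rep_word_prod[of "[s]"] by (auto simp: fun_eq_iff)

lemma rep_mult:
  assumes "x \<in> carrier W" "y \<in> carrier W"
  shows "rep (x \<otimes> y) v = rep x (rep y v)"
proof -
  obtain xs where xs: "xs \<in> lists S" "word_prod W xs = x" using assms(1) by (rule rep_cases)
  obtain ys where ys: "ys \<in> lists S" "word_prod W ys = y" using assms(2) by (rule rep_cases)
  have "rep (x \<otimes> y) = act (xs @ ys)"
    using rep_word_prod[of "xs @ ys"] xs ys by (simp add: ball_Un)
  then show ?thesis
    using rep_word_prod[OF xs(1)] rep_word_prod[OF ys(1)] xs(2) ys(2) by simp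
qed

lemma rep_inv [simp]:
  "w \<in> carrier W \<Longrightarrow> rep (inv w) (rep w v) = v"
  "w \<in> carrier W \<Longrightarrow> rep w (rep (inv w) v) = v"
  by (simp_all flip: rep_mult)

lemma rep_lincomb:
  "rep w (\<lambda>r. p * u r + q * v r) = (\<lambda>r. p * rep w u r + q * rep w v r)"
  by (simp add: rep_def act_lincomb)

lemma rep_scale: "rep w (\<lambda>r. p * u r) = (\<lambda>r. p * rep w u r)"
  by (simp add: rep_def act_scale)

lemma rep_uminus: "rep w (\<lambda>r. - u r) = (\<lambda>r. - rep w u r)"
  using rep_scale[of w "-1" u] by simp

lemma rep_expand: "supported v \<Longrightarrow> rep w v r = (\<Sum>s\<in>S. v s * rep w (unit_vec s) r)"
  unfolding rep_def by (rule act_expand)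

lemma supported_rep: "w \<in> carrier W \<Longrightarrow> supported v \<Longrightarrow> supported (rep w v)"
  by (erule rep_cases) (simp add: supported_act)

text \<open>
  Writing \<open>w = v z\<close> with \<open>z\<close> an alternating word in \<open>s\<close> and a descent \<open>t\<close> of \<open>w\<close>, and \<open>v\<close> as short as
  possible, the root \<open>z s\<close> is a nonnegative combination of \<open>s\<close> and \<open>t\<close>, neither of which is a
  descent of \<open>v\<close>.
\<close>

lemma rep_unit_vec_nonneg:
  "w \<in> carrier W \<Longrightarrow> s \<in> S \<Longrightarrow> len w \<le> len (w \<otimes> s) \<Longrightarrow> 0 \<le> rep w (unit_vec s) r"
proof (induction "len w" arbitrary: w s r rule: less_induct)
  case less
  note w = less.prems(1) and s = less.prems(2)
  show ?case
  proof (cases "w = \<one>")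
    case True
    then show ?thesis by (simp add: unit_vec_nonneg)
  next
    case False
    obtain t where t: "t \<in> S" and len_wt: "len (w \<otimes> t) < len w"
      using ex_descent[OF w False] by auto
    then have "s \<noteq> t" using less.prems(3) by auto
    \<comment> \<open>\<open>P n\<close> says that \<open>n\<close> is the length of a left factor
      whose complement is a word in \<open>s\<close> and \<open>t\<close>, with lengths adding up;
      \<open>v\<close> will be the shortest such factor.\<close>
    define P where "P n \<longleftrightarrow> (\<exists>v zs. v \<in> carrier W \<and> zs \<in> lists {s, t} \<and> w = v \<otimes> word_prod W zs \<and>
      len w = len v + length zs \<and> n = len v)" for n
    have Pwt: "P (len (w \<otimes> t))"
      unfolding P_def
      using w t len_wt len_le_mult_gen[OF w t]
      by (intro exI[of _ "w \<otimes> t"] exI[of _ "[t]"]) auto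
    obtain v zs where v: "v \<in> carrier W" "zs \<in> lists {s, t}" "w = v \<otimes> word_prod W zs"
      "len w = len v + length zs" and least: "\<And>n. P n \<Longrightarrow> len v \<le> n"
    proof -
      define l where "l = (LEAST n. P n)"
      have "P l" unfolding l_def by (rule LeastI[of P, OF Pwt])
      moreover have "l \<le> n" if "P n" for n
        unfolding l_def by (rule Least_le[of P, OF that])
      ultimately show ?thesis using that unfolding P_def[of l] by blast
    qed
    have "len v < len w"
      using least[OF Pwt] len_wt by simp
    have st: "{s, t} \<subseteq> S" using s t by auto
    have zs: "zs \<in> lists S" using v(2) st by (meson lists_mono subsetD)
    \<comment> \<open>A descent \<open>u\<close> of \<open>v\<close> could be moved into the word
      \<open>zs\<close>, against minimality.\<close>
    have asc: "len v \<le> len (v \<otimes> u)" if u: "u \<in> {s, t}" for u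
    proof (rule ccontr)
      assume "\<not> len v \<le> len (v \<otimes> u)"
      moreover have "u \<in> S" using u st by auto
      ultimately have "P (len (v \<otimes> u))"
        unfolding P_def using v u zs len_le_mult_gen[OF v(1), of u]
        by (intro exI[of _ "v \<otimes> u"] exI[of _ "u # zs"]) (auto simp: m_assoc)
      then show False
        using least \<open>\<not> len v \<le> len (v \<otimes> u)\<close> by blast
    qed
    have red: "length zs \<le> len (word_prod W zs)"
      using len_mult_le[OF v(1), of "word_prod W zs"] zs v by simp
    define n where "n = length zs"
    have "last zs = t" if "zs \<noteq> []"
    proof (rule ccontr)
      assume "last zs \<noteq> t"
      moreover have "last zs \<in> {s, t}" using v(2) that by auto
      ultimately have "last zs = s" by simp
      define us where "us = butlast zs"
      have us: "zs = us @ [s]"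
        using append_butlast_last_id[OF \<open>zs \<noteq> []\<close>] \<open>last zs = s\<close> by (simp add: us_def)
      have "us \<in> lists S" using zs us by auto
      then have "w \<otimes> s = v \<otimes> word_prod W us"
        using v(1,3) us s by (simp add: m_assoc)
      then have "len (w \<otimes> s) \<le> len v + length us"
        using len_mult_le[OF v(1), of "word_prod W us"] len_word_prod_le[of us] \<open>us \<in> lists S\<close>
        by simp
      then show False using less.prems(3) v(4) us by simp
    qed
    then have alt: "zs = alt n s t"
      unfolding n_def
      using v(2) reduced_distinct_adj[OF zs red] \<open>s \<noteq> t\<close> by (intro distinct_adj_eq_alt) auto
    \<comment> \<open>Otherwise the last \<open>k\<close> letters of \<open>zs\<close> followed by
      \<open>s\<close> are \<open>k + 1\<close> alternating letters, which the relator of length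
      \<open>2 * k\<close> turns into \<open>k - 1\<close> letters; then \<open>s\<close> would be a
      descent of \<open>w\<close>.\<close>
    have n_less: "n < k" if k: "m s t = enat k" for k
    proof (rule ccontr)
      assume "\<not> n < k"
      have "2 \<le> k" using m_ge_2[OF s t \<open>s \<noteq> t\<close> k] .
      obtain us where us: "us \<in> lists {s, t}" "length us = n - k" "zs = us @ alt k s t"
        using alt_add[of s t "n - k" k] \<open>\<not> n < k\<close> alt by auto
      obtain us' where us': "us' \<in> lists {t, s}" "length us' = k - 1"
        "alt (2 * k) t s = us' @ alt (Suc k) t s"
        using alt_add[of t s "k - 1" "Suc k"] \<open>2 \<le> k\<close> by (auto simp: mult_2)
      have lists: "us \<in> lists S" "us' \<in> lists S" "alt k s t \<in> lists S" "alt (Suc k) t s \<in> lists S"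
        using us(1) us'(1) s t set_alt[of k s t] by auto
      have "word_prod W us' \<otimes> word_prod W (alt (Suc k) t s) = \<one>"
        using word_prod_relator[OF t s, of k] k m_sym[OF s t] us'(3) alt_double[of k t s]
          word_prod_append[OF lists(2,4)] by simp
      then have "word_prod W (alt (Suc k) t s) = inv (word_prod W us')"
        using inv_equality[of "word_prod W us'" "word_prod W (alt (Suc k) t s)"] lists(2,4)
        by (metis inv_comm inv_equality word_prod_closed)
      then have "word_prod W (alt (Suc k) t s) = word_prod W (rev us')"
        using inv_word_prod[OF lists(2)] by simp
      moreover have "w \<otimes> s = v \<otimes> (word_prod W us \<otimes> word_prod W (alt (Suc k) t s))"
        using v(1,3) us(3) lists s by (simp add: m_assoc)
      ultimately have "w \<otimes> s = v \<otimes> word_prod W (us @ rev us')"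
        using lists by auto
      moreover have "us @ rev us' \<in> lists S"
        using lists(1,2) by auto
      ultimately have "len (w \<otimes> s) \<le> len v + (n - k + (k - 1))"
        using len_mult_le[OF v(1) word_prod_closed, of "us @ rev us'"]
          len_word_prod_le[of "us @ rev us'"] us(2) us'(2)
        by (simp del: word_prod_append in_lists_conv_set)
      then show False
        using less.prems(3) v(4) \<open>2 \<le> k\<close> \<open>\<not> n < k\<close> n_def by simp
    qed
    \<comment> \<open>Up to the factor \<open>x 1\<close> these are the root coefficients of the
      dihedral group: \<open>sin (i * pi / k)\<close>, or \<open>i\<close> for an infinite bond. As
      \<open>n < k\<close>, the angle is at most \<open>pi\<close> up to
      \<open>i = n + 1\<close>.\<close>
    obtain x :: "nat \<Rightarrow> real" where x: "x 0 = 0" "0 < x 1"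
      "\<And>i. x (i + 2) = bond m s t * x (i + 1) - x i" "\<And>i. i \<le> n + 1 \<Longrightarrow> 0 \<le> x i"
    proof (cases "m s t")
      case (enat k)
      have "2 \<le> k" using m_ge_2[OF s t \<open>s \<noteq> t\<close> enat] .
      show ?thesis
      proof (rule that)
        show "0 < sin (real 1 * (pi / real k))"
          using \<open>2 \<le> k\<close> by (intro sin_gt_zero) (auto simp: field_simps)
        show "sin (real (i + 2) * (pi / real k))
          = bond m s t * sin (real (i + 1) * (pi / real k)) - sin (real i * (pi / real k))" for i
          using sin_recurrence[of i "pi / real k"] enat by (simp add: bond_def)
        show "0 \<le> sin (real i * (pi / real k))" if "i \<le> n + 1" for i
          using that n_less[OF enat] \<open>2 \<le> k\<close> by (intro sin_ge_zero) (auto simp: field_simps)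
      qed simp
    next
      case infinity
      show ?thesis
        by (rule that[of real]) (simp_all add: bond_def infinity)
    qed
    obtain p q where pq: "{p, q} = {s, t}" and
      act: "act zs (\<lambda>r. x 1 * unit_vec s r) = (\<lambda>r. x (n + 1) * unit_vec p r + x n * unit_vec q r)"
      using act_alt[OF s t \<open>s \<noteq> t\<close>, of x n 0] x(1,3) alt by auto
    have pqS: "p \<in> {s, t}" "q \<in> {s, t}" using pq by auto
    have "x 1 * rep w (unit_vec s) r = rep v (rep (word_prod W zs) (\<lambda>r. x 1 * unit_vec s r)) r"
      using v(1) zs by (simp add: v(3) rep_mult rep_scale)
    also have "\<dots> = x (n + 1) * rep v (unit_vec p) r + x n * rep v (unit_vec q) r"
      unfolding rep_word_prod[OF zs] act rep_lincomb ..
    also have "\<dots> \<ge> 0"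
      using x(4) less.hyps[OF \<open>len v < len w\<close> v(1)] asc pqS st by (intro add_nonneg_nonneg mult_nonneg_nonneg) auto
    finally show ?thesis
      using x(2) by (simp add: zero_le_mult_iff)
  qed
qed

end

lemma set_subseq: "subseq xs ys \<Longrightarrow> set xs \<subseteq> set ys"
  by (induction rule: list_emb.induct) auto

lemma subseq_in_lists: "subseq xs ys \<Longrightarrow> ys \<in> lists A \<Longrightarrow> xs \<in> lists A"
  using set_subseq by fastforce

context finite_rank_coxeter
begin

section \<open>Exchange and products of subwords\<close>

lemma rep_unit_vec_nonzero:
  assumes "w \<in> carrier W"
  shows "\<exists>r. rep w (unit_vec s) r \<noteq> 0"
proof (rule ccontr)
  assume "\<nexists>r. rep w (unit_vec s) r \<noteq> 0"
  then have "rep w (unit_vec s) = (\<lambda>r. 0 * unit_vec s r)" by auto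
  then have "rep (inv w) (rep w (unit_vec s)) = (\<lambda>r. 0 * rep (inv w) (unit_vec s) r)"
    by (simp only: rep_scale)
  then show False
    using assms by (auto dest: fun_cong[of _ _ s])
qed

lemma rep_mult_gen_unit_vec:
  assumes "w \<in> carrier W" "s \<in> S"
  shows "rep (w \<otimes> s) (unit_vec s) = (\<lambda>r. - rep w (unit_vec s) r)"
  using assms by (simp add: rep_mult rep_gen reflect_unit_vec_self rep_uminus)

text \<open>\<open>w \<otimes> s\<close> sends the simple root \<open>s\<close> to the negative of
  its image under \<open>w\<close>. Positivity for \<open>w \<otimes> s\<close> gives one direction;
  positivity for \<open>w\<close>, with invertibility, gives the other.\<close>

lemma descent_iff:
  assumes w: "w \<in> carrier W" and s: "s \<in> S"
  shows "len (w \<otimes> s) < len w \<longleftrightarrow> (\<forall>r. rep w (unit_vec s) r \<le> 0)"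
proof
  assume "len (w \<otimes> s) < len w"
  then have "0 \<le> rep (w \<otimes> s) (unit_vec s) r" for r
    using w s by (intro rep_unit_vec_nonneg) auto
  then show "\<forall>r. rep w (unit_vec s) r \<le> 0"
    by (simp add: rep_mult_gen_unit_vec w s)
next
  assume *: "\<forall>r. rep w (unit_vec s) r \<le> 0"
  show "len (w \<otimes> s) < len w"
  proof (rule ccontr)
    assume "\<not> len (w \<otimes> s) < len w"
    then have "0 \<le> rep w (unit_vec s) r" for r
      using rep_unit_vec_nonneg[OF w s] by simp
    then show False
      using * rep_unit_vec_nonzero[OF w, of s] by (meson order_antisym)
  qed
qed

text \<open>A sign argument in place of parity: with equal lengths, positivity for \<open>w\<close>
  would make \<open>s\<close> a descent of \<open>w \<otimes> s\<close>.\<close>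

lemma len_mult_gen_neq:
  assumes w: "w \<in> carrier W" and s: "s \<in> S"
  shows "len (w \<otimes> s) \<noteq> len w"
proof
  assume eq: "len (w \<otimes> s) = len w"
  have "0 \<le> rep w (unit_vec s) r" for r
    using rep_unit_vec_nonneg[OF w s] eq by simp
  then have "\<forall>r. rep (w \<otimes> s) (unit_vec s) r \<le> 0"
    by (simp add: rep_mult_gen_unit_vec w s)
  then show False
    using descent_iff[of "w \<otimes> s" s] w s eq by simp
qed

text \<open>Stands in for faithfulness: no generator can be a descent of \<open>w\<close>, which
  leaves only the identity. Applied to a quotient, it proves equalities in the group.\<close>

lemma eq_one_if_rep_pos:
  assumes w: "w \<in> carrier W" and "\<And>s. s \<in> S \<Longrightarrow> \<exists>r. 0 < rep w (unit_vec s) r"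
  shows "w = \<one>"
  using ex_descent[OF w] descent_iff[OF w] assms(2) by (meson not_le)

text \<open>The factor 1 brings the right-hand side into the shape of
  \<open>rep_lincomb\<close>.\<close>

lemma reflect_diff: "reflect s v = (\<lambda>r. 1 * v r + (reflect s v s - v s) * unit_vec s r)"
  by (auto simp: reflect_def unit_vec_def)

text \<open>\<open>g s g^-1\<close> is the reflection in the root \<open>g s\<close>, here a
  multiple of \<open>t\<close>, so it should be \<open>t\<close>. To see this,
  \<open>g s g^-1 t\<close> is shown to keep coordinate \<open>r\<close> of each simple root
  \<open>r\<close> equal to 1.\<close>

lemma conj_gen_eq_gen:
  assumes g: "g \<in> carrier W" and s: "s \<in> S" and t: "t \<in> S" and "\<kappa> \<noteq> 0"
    and root: "rep g (unit_vec s) = (\<lambda>r. \<kappa> * unit_vec t r)"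
  shows "g \<otimes> s = t \<otimes> g"
proof -
  define h where "h = g \<otimes> s \<otimes> inv g \<otimes> t"
  have h: "h \<in> carrier W" using g s t by (simp add: h_def)
  have rep_h: "rep h v = rep g (reflect s (rep (inv g) (reflect t v)))" for v
    using g s t by (simp add: h_def rep_mult rep_gen)
  have refl_g: "rep g (reflect s (rep (inv g) u)) =
    (\<lambda>r. u r + (reflect s (rep (inv g) u) s - rep (inv g) u s) * (\<kappa> * unit_vec t r))" for u
    by (subst reflect_diff, subst rep_lincomb) (simp add: g root)
  have "h = \<one>"
  proof (rule eq_one_if_rep_pos[OF h])
    fix r assume "r \<in> S"
    show "\<exists>q. 0 < rep h (unit_vec r) q"
    proof (cases "r = t")
      case True
      have "rep (inv g) (rep g (unit_vec s)) = (\<lambda>r. \<kappa> * rep (inv g) (unit_vec t) r)"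
        by (simp only: root rep_scale)
      then have inv_t: "rep (inv g) (unit_vec t) = (\<lambda>r. (1 / \<kappa>) * unit_vec s r)"
        using g \<open>\<kappa> \<noteq> 0\<close> by (simp add: fun_eq_iff)
      have "rep (inv g) (reflect t (unit_vec t)) = (\<lambda>r. (- 1 / \<kappa>) * unit_vec s r)"
        by (simp add: reflect_unit_vec_self rep_uminus inv_t)
      then have "rep h (unit_vec t) = (\<lambda>r. (1 / \<kappa>) * rep g (unit_vec s) r)"
        unfolding rep_h
        using reflect_lincomb[of s "- 1 / \<kappa>" "unit_vec s" 0 "unit_vec s"]
          rep_scale[of g "1 / \<kappa>" "unit_vec s"]
        by (simp add: reflect_unit_vec_self)
      then have "rep h (unit_vec t) t = 1"
        using \<open>\<kappa> \<noteq> 0\<close> by (simp add: root)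
      then show ?thesis using True by (intro exI[of _ t]) simp
    next
      case False
      then have "rep h (unit_vec r) r = 1"
        unfolding rep_h refl_g using reflect_unit_vec[OF \<open>r \<in> S\<close> False]
        by (simp add: unit_vec_other)
      then show ?thesis by (intro exI[of _ r]) simp
    qed
  qed
  then have "g \<otimes> s \<otimes> inv g = inv t"
    unfolding h_def using g s t inv_equality[of "g \<otimes> s \<otimes> inv g" t] by simp
  then have "g \<otimes> s \<otimes> inv g \<otimes> g = t \<otimes> g" using t by simp
  then show ?thesis using g s by (simp add: m_assoc)
qed

text \<open>Letters act from the right end. The simple root starts out nonnegative, so some letter
  produces the first negative coordinate.\<close>

lemma act_sign_change:
  assumes "\<exists>r. act xs (unit_vec s) r < 0"
  shows "\<exists>ps t qs. xs = ps @ t # qs \<and> (\<forall>r. 0 \<le> act qs (unit_vec s) r) \<and>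
    (\<exists>r. act (t # qs) (unit_vec s) r < 0)"
  using assms
proof (induction xs)
  case Nil
  then show ?case using unit_vec_nonneg[of s] by (auto simp: not_less[symmetric])
next
  case (Cons x xs)
  show ?case
  proof (cases "\<exists>r. act xs (unit_vec s) r < 0")
    case True
    then obtain ps t qs where "xs = ps @ t # qs" "\<forall>r. 0 \<le> act qs (unit_vec s) r"
      "\<exists>r. act (t # qs) (unit_vec s) r < 0"
      using Cons.IH by blast
    then show ?thesis by (intro exI[of _ "x # ps"] exI[of _ t] exI[of _ qs]) auto
  next
    case False
    then show ?thesis using Cons.prems
      by (intro exI[of _ "[]"] exI[of _ x] exI[of _ xs]) (auto simp: not_less)
  qed
qed

text \<open>At the sign change the root \<open>g s\<close> is nonnegative and its reflection in
  \<open>t\<close> is nonpositive. That reflection alters coordinate \<open>t\<close> only, so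
  \<open>g s\<close> is a multiple of \<open>t\<close>, and
  \<open>g \<otimes> s = t \<otimes> g\<close> cancels the letter \<open>t\<close>. This covers
  words that are not reduced.\<close>

lemma exchange:
  assumes xs: "xs \<in> lists S" and s: "s \<in> S"
    and desc: "len (word_prod W xs \<otimes> s) < len (word_prod W xs)"
  shows "\<exists>ps t qs. xs = ps @ t # qs \<and> word_prod W xs \<otimes> s = word_prod W (ps @ qs)"
proof -
  have "\<forall>r. act xs (unit_vec s) r \<le> 0" "\<exists>r. act xs (unit_vec s) r \<noteq> 0"
    using descent_iff[of "word_prod W xs" s] rep_unit_vec_nonzero[of "word_prod W xs" s]
      xs s desc rep_word_prod[OF xs] by auto
  then have "\<exists>r. act xs (unit_vec s) r < 0" by (metis less_eq_real_def)
  then obtain ps t qs where eq: "xs = ps @ t # qs" and pos: "\<And>r. 0 \<le> act qs (unit_vec s) r"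
    and neg: "\<exists>r. act (t # qs) (unit_vec s) r < 0"
    using act_sign_change by blast
  have lists: "ps \<in> lists S" "t \<in> S" "qs \<in> lists S" using xs eq by auto
  define g where "g = word_prod W qs"
  have g: "g \<in> carrier W" "rep g = act qs"
    using lists rep_word_prod[of qs] by (simp_all add: g_def)
  have rep_tg: "rep (t \<otimes> g) (unit_vec s) = reflect t (act qs (unit_vec s))"
    using lists g by (simp add: rep_mult rep_gen)
  have "len (t \<otimes> g \<otimes> s) < len (t \<otimes> g)"
  proof (rule ccontr)
    assume "\<not> ?thesis"
    then have "0 \<le> rep (t \<otimes> g) (unit_vec s) r" for r
      using lists g s by (intro rep_unit_vec_nonneg) auto
    then show False using neg rep_tg by (auto simp: not_less[symmetric])
  qed
  then have "\<forall>r. reflect t (act qs (unit_vec s)) r \<le> 0"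
    using descent_iff[of "t \<otimes> g" s] lists g s rep_tg by simp
  then have zero: "act qs (unit_vec s) r = 0" if "r \<noteq> t" for r
    using pos[of r] that by (auto simp: reflect_def dest!: spec[of _ r])
  define \<kappa> where "\<kappa> = act qs (unit_vec s) t"
  have root: "rep g (unit_vec s) = (\<lambda>r. \<kappa> * unit_vec t r)"
    using zero g by (auto simp: \<kappa>_def unit_vec_def)
  then have "\<kappa> \<noteq> 0" using rep_unit_vec_nonzero[OF g(1), of s] by auto
  then have "g \<otimes> s = t \<otimes> g"
    using conj_gen_eq_gen[OF g(1) s lists(2) _ root] by simp
  then have "word_prod W xs \<otimes> s = word_prod W (ps @ qs)"
    using eq lists g s by (simp add: m_assoc flip: g_def)
  then show ?thesis using eq by blast
qed

text \<open>For a reduced word this is the lower Bruhat interval of its product; the facts below are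
  phrased for arbitrary words.\<close>

definition subwords :: "'a list \<Rightarrow> 'a set" where
  "subwords xs = {word_prod W ys | ys. subseq ys xs}"

lemma subwords_subset_carrier:
  assumes "xs \<in> lists S"
  shows "subwords xs \<subseteq> carrier W"
proof
  fix w assume "w \<in> subwords xs"
  then obtain ys where "w = word_prod W ys" "subseq ys xs" by (auto simp: subwords_def)
  then show "w \<in> carrier W"
    using word_prod_closed[OF subseq_in_lists[OF _ assms]] by simp
qed

lemma subwords_prefix: "subwords xs \<subseteq> subwords (xs @ ys)"
  by (auto simp: subwords_def intro: subseq_rev_drop_many)

text \<open>Exchange deletes one more letter from a subword with product \<open>w\<close>.\<close>

lemma subwords_descent:
  assumes xs: "xs \<in> lists S" and w: "w \<in> subwords xs" and s: "s \<in> S" and "len (w \<otimes> s) < len w"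
  shows "w \<otimes> s \<in> subwords xs"
proof -
  obtain ys where ys: "w = word_prod W ys" "subseq ys xs" using w by (auto simp: subwords_def)
  then have "ys \<in> lists S" using xs set_subseq[of ys xs] by auto
  then obtain ps t qs where eq: "ys = ps @ t # qs" "w \<otimes> s = word_prod W (ps @ qs)"
    using exchange[of ys s] assms(4) s ys(1) by auto
  have "subseq (ps @ qs) ys" unfolding eq(1) subseq_append' by (rule list_emb_Cons) simp
  then have "subseq (ps @ qs) xs" using ys(2) by (rule subseq_order.trans)
  then show ?thesis using eq(2) by (auto simp: subwords_def)
qed

text \<open>The lifting property of the Bruhat order, for words that need not be reduced.\<close>

lemma subwords_snoc:
  assumes xs: "xs \<in> lists S" and s: "s \<in> S" and w: "w \<in> subwords (xs @ [s])"
  shows "(if len (w \<otimes> s) < len w then w \<otimes> s else w) \<in> subwords xs"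
proof -
  obtain ys where ys: "w = word_prod W ys" "subseq ys (xs @ [s])"
    using w by (auto simp: subwords_def)
  then obtain ps qs where pq: "ys = ps @ qs" "subseq ps xs" "subseq qs [s]"
    unfolding subseq_append_iff by blast
  have ps: "ps \<in> lists S" using pq(2) xs set_subseq[of ps xs] by auto
  have in_sub: "word_prod W ps \<in> subwords xs" using pq(2) by (auto simp: subwords_def)
  have "qs = [] \<or> qs = [s]" using pq(3) by (cases qs) (auto split: if_splits)
  then show ?thesis
  proof
    assume "qs = []"
    then have "w = word_prod W ps" using ys(1) pq(1) by simp
    then show ?thesis using subwords_descent[OF xs in_sub s] in_sub by auto
  next
    assume "qs = [s]"
    then have "w = word_prod W ps \<otimes> s" using ys(1) pq(1) ps s by simp
    then have ws: "word_prod W ps = w \<otimes> s" "w \<in> carrier W" using ps s by auto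
    \<comment> \<open>If \<open>s\<close> is not a descent of \<open>w\<close>, it is one of
      \<open>w \<otimes> s\<close>, the product of \<open>ps\<close>; stripping it gives back
      \<open>w\<close>.\<close>
    have "w \<in> subwords xs" if "\<not> len (w \<otimes> s) < len w"
      using subwords_descent[OF xs in_sub s] ws s that len_mult_gen_neq[OF ws(2) s] by simp
    then show ?thesis using in_sub ws(1) by auto
  qed
qed

text \<open>A word changes only the coordinates of its own letters. Each \<open>s\<close> is missing
  from one of the two words, so \<open>w\<close> keeps coordinate \<open>s\<close> of the simple
  root \<open>s\<close> equal to 1.\<close>

lemma subwords_disjoint:
  assumes "xs \<in> lists S" "ys \<in> lists S" "set xs \<inter> set ys = {}"
    and w: "w \<in> subwords xs" "w \<in> subwords ys"
  shows "w = \<one>"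
proof -
  obtain us vs where us: "subseq us xs" "w = word_prod W us"
    and vs: "subseq vs ys" "w = word_prod W vs"
    using w by (auto simp: subwords_def)
  have lists: "us \<in> lists S" "vs \<in> lists S" and disj: "set us \<inter> set vs = {}"
    using us(1) vs(1) assms(1-3) set_subseq[of us xs] set_subseq[of vs ys] by auto
  have outside: "act zs v r = v r" if "r \<notin> set zs" for zs v r
    using that by (induction zs) (auto simp: reflect_def)
  show ?thesis
  proof (rule eq_one_if_rep_pos)
    show "w \<in> carrier W" using us(2) lists by simp
    fix s assume "s \<in> S"
    have "rep w = act us" "rep w = act vs"
      using rep_word_prod[OF lists(1)] rep_word_prod[OF lists(2)] us(2) vs(2) by simp_all
    then have "rep w (unit_vec s) s = unit_vec s s"
      using outside[of s us] outside[of s vs] disj by (metis disjoint_iff)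
    then show "\<exists>r. 0 < rep w (unit_vec s) r" by (intro exI[of _ s]) simp
  qed
qed

section \<open>The longest element\<close>

lemma rep_nonpos_if_all_descents:
  assumes v: "v \<in> carrier W" and desc: "\<And>s. s \<in> S \<Longrightarrow> len (v \<otimes> s) < len v"
    and u: "supported u" "\<And>r. 0 \<le> u r"
  shows "rep v u r \<le> 0"
  unfolding rep_expand[OF u(1)]
  using u(2) desc descent_iff[OF v] by (intro sum_nonpos mult_nonneg_nonpos) auto

text \<open>Both elements make all simple roots negative. So does \<open>inv v\<close>: a
  nonnegative \<open>inv v q\<close> would be sent by \<open>v\<close> to a nonpositive vector, yet
  it is sent to \<open>q\<close>. Hence \<open>inv v \<otimes> x\<close> keeps the simple roots
  nonnegative.\<close>

lemma all_descents_unique: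
  assumes v: "v \<in> carrier W" "\<And>s. s \<in> S \<Longrightarrow> len (v \<otimes> s) < len v"
    and x: "x \<in> carrier W" "\<And>s. s \<in> S \<Longrightarrow> len (x \<otimes> s) < len x"
  shows "x = v"
proof -
  have inv_v: "rep (inv v) (unit_vec q) r \<le> 0" if q: "q \<in> S" for q r
  proof (rule ccontr)
    assume "\<not> ?thesis"
    then have "\<not> len (inv v \<otimes> q) < len (inv v)"
      using descent_iff[of "inv v" q] v(1) q by auto
    then have "0 \<le> rep (inv v) (unit_vec q) r" for r
      using v(1) q by (intro rep_unit_vec_nonneg) auto
    then have "rep v (rep (inv v) (unit_vec q)) q \<le> 0"
      using v q by (intro rep_nonpos_if_all_descents supported_rep supported_unit_vec) auto
    then show False using v(1) by simp
  qed
  have "inv v \<otimes> x = \<one>"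
  proof (rule eq_one_if_rep_pos)
    show "inv v \<otimes> x \<in> carrier W" using v x by simp
    fix s assume s: "s \<in> S"
    have "rep (inv v \<otimes> x) (unit_vec s) r
        = (\<Sum>q\<in>S. rep x (unit_vec s) q * rep (inv v) (unit_vec q) r)" for r
      using v x s by (simp add: rep_mult rep_expand[OF supported_rep] supported_unit_vec)
    moreover have "0 \<le> (\<Sum>q\<in>S. rep x (unit_vec s) q * rep (inv v) (unit_vec q) r)" for r
      using inv_v descent_iff[OF x(1) s] x(2)[OF s] by (intro sum_nonneg mult_nonpos_nonpos) auto
    ultimately show "\<exists>r. 0 < rep (inv v \<otimes> x) (unit_vec s) r"
      using rep_unit_vec_nonzero[of "inv v \<otimes> x" s] v x
      by (metis inv_closed less_eq_real_def m_closed)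
  qed
  then show ?thesis
    using v x by (metis inv_inv inv_closed inv_equality inv_comm)
qed

text \<open>Multiplying by ascents leads from any \<open>x\<close> up to the one element with all
  descents, which is the product of \<open>xs\<close>; walking back down stays in
  \<open>subwords xs\<close>.\<close>

lemma subwords_eq_carrier:
  assumes fin: "finite (carrier W)" and xs: "xs \<in> lists S"
    and desc: "\<And>s. s \<in> S \<Longrightarrow> len (word_prod W xs \<otimes> s) < len (word_prod W xs)"
  shows "subwords xs = carrier W"
proof
  define N where "N = Max (len ` carrier W)"
  have len_le: "len x \<le> N" if "x \<in> carrier W" for x
    using fin that by (simp add: N_def)
  have "x \<in> subwords xs" if "x \<in> carrier W" for x
    using that
  proof (induction "N - len x" arbitrary: x rule: less_induct)
    case less
    show ?case
    proof (cases "\<forall>s\<in>S. len (x \<otimes> s) < len x")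
      case True
      then have "x = word_prod W xs"
        using all_descents_unique[OF _ desc less.prems] xs by simp
      then show ?thesis by (auto simp: subwords_def)
    next
      case False
      then obtain s where s: "s \<in> S" "len x < len (x \<otimes> s)"
        using len_mult_gen_neq[OF less.prems] by (metis linorder_neqE_nat)
      then have "x \<otimes> s \<in> subwords xs"
        using less.prems len_le[of "x \<otimes> s"] by (intro less.hyps) auto
      then show ?thesis
        using subwords_descent[OF xs, of "x \<otimes> s" s] s less.prems by simp
    qed
  qed
  then show "carrier W \<subseteq> subwords xs" by auto
qed (rule subwords_subset_carrier[OF xs])

text \<open>Closure of \<open>subwords xs\<close> downwards in the right weak order: because lengths
  add, a descent of \<open>g\<close> is a descent of \<open>x \<otimes> g\<close>, and
  \<open>g\<close> is used up letter by letter.\<close>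

lemma subwords_strip:
  assumes xs: "xs \<in> lists S" and x: "x \<in> carrier W"
  shows "g \<in> carrier W \<Longrightarrow> len (x \<otimes> g) = len x + len g \<Longrightarrow> x \<otimes> g \<in> subwords xs
    \<Longrightarrow> x \<in> subwords xs"
proof (induction "len g" arbitrary: g rule: less_induct)
  case less
  show ?case
  proof (cases "g = \<one>")
    case True
    then show ?thesis using less.prems x by simp
  next
    case False
    then obtain s where s: "s \<in> S" "len (g \<otimes> s) < len g"
      using ex_descent less.prems(1) by blast
    have le: "len (x \<otimes> (g \<otimes> s)) \<le> len x + len (g \<otimes> s)"
      using x s less.prems(1) by (intro len_mult_le) auto
    have assoc: "x \<otimes> (g \<otimes> s) = x \<otimes> g \<otimes> s" using x s less.prems(1) by (simp add: m_assoc)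
    have "len (x \<otimes> g) \<le> len (x \<otimes> g \<otimes> s) + 1"
      using x s less.prems(1) by (intro len_le_mult_gen) auto
    then have eq: "len (x \<otimes> (g \<otimes> s)) = len x + len (g \<otimes> s)"
      using le assoc s less.prems(2) by simp
    have "x \<otimes> g \<otimes> s \<in> subwords xs"
      by (rule subwords_descent[OF xs less.prems(3) s(1)]) (use le assoc s less.prems in simp)
    then show ?thesis
      using less.hyps[OF s(2) _ eq] s less.prems(1) assoc by simp
  qed
qed

text \<open>
  With \<open>w = x g\<close> reduced, the hypothesis on descents says that \<open>x\<close> lies below \<open>w\<close> and below
  \<open>w s\<close> for every descent \<open>s\<close> of \<open>w\<close> in the block \<open>js\<close>.
\<close>

lemma subwords_strip_block:
  assumes xs: "xs \<in> lists S" and x: "x \<in> carrier W"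
  shows "js \<in> lists S \<Longrightarrow> distinct js \<Longrightarrow>
    (\<And>s t. s \<in> set js \<Longrightarrow> t \<in> set js \<Longrightarrow> s \<noteq> t \<Longrightarrow> bond m s t = 0) \<Longrightarrow>
    g \<in> carrier W \<Longrightarrow> len (x \<otimes> g) = len x + len g \<Longrightarrow> x \<otimes> g \<in> subwords (xs @ js) \<Longrightarrow>
    (\<And>s. s \<in> set js \<Longrightarrow> len (x \<otimes> g \<otimes> s) < len (x \<otimes> g) \<Longrightarrow> len (g \<otimes> s) < len g) \<Longrightarrow>
    x \<in> subwords xs"
proof (induction js arbitrary: g rule: rev_induct)
  case Nil
  then show ?case using subwords_strip[OF xs x, of g] by simp
next
  case (snoc s js)
  note g = snoc.prems(4)
  have s: "s \<in> S" and js: "js \<in> lists S" using snoc.prems(1) by auto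
  have xg: "x \<otimes> g \<in> carrier W" using x g by simp
  have step: "(if len (x \<otimes> g \<otimes> s) < len (x \<otimes> g) then x \<otimes> g \<otimes> s else x \<otimes> g) \<in> subwords (xs @ js)"
    using subwords_snoc[of "xs @ js" s "x \<otimes> g"] xs js s snoc.prems(6) by (simp add: ball_Un)
  show ?case
  proof (cases "len (x \<otimes> g \<otimes> s) < len (x \<otimes> g)")
    case False
    then show ?thesis
      using step snoc.prems(1,2,4,5) by (intro snoc.IH[of g] snoc.prems(3,7)) auto
  next
    case True
    then have gs: "len (g \<otimes> s) < len g" using snoc.prems(7)[of s] by simp
    have assoc: "x \<otimes> (g \<otimes> s) = x \<otimes> g \<otimes> s" using x s g by (simp add: m_assoc)
    show ?thesis
    proof (rule snoc.IH[of "g \<otimes> s"])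
      show "len (x \<otimes> (g \<otimes> s)) = len x + len (g \<otimes> s)"
        using gs True len_le_mult_gen[OF g s] len_le_mult_gen[OF xg s] snoc.prems(5) assoc by simp
      show "x \<otimes> (g \<otimes> s) \<in> subwords (xs @ js)" using step True assoc by simp
      fix t assume t: "t \<in> set js" and desc: "len (x \<otimes> (g \<otimes> s) \<otimes> t) < len (x \<otimes> (g \<otimes> s))"
      have tS: "t \<in> S" and "t \<noteq> s" using t js snoc.prems(2) by auto
      \<comment> \<open>\<open>s\<close> and \<open>t\<close> are orthogonal, so \<open>s\<close>
        fixes the root \<open>t\<close>, and \<open>t\<close> is a descent of
        \<open>y \<otimes> s\<close> iff it is one of \<open>y\<close>. This carries the hypothesis
        on descents from \<open>g\<close> over to \<open>g \<otimes> s\<close>.\<close>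
      then have "reflect s (unit_vec t) = unit_vec t"
        using reflect_unit_vec[of t s] snoc.prems(3)[of s t] t by simp
      then have same: "rep (y \<otimes> s) (unit_vec t) = rep y (unit_vec t)" if "y \<in> carrier W" for y
        using that s by (simp add: rep_mult rep_gen)
      have "len (x \<otimes> g \<otimes> t) < len (x \<otimes> g)"
        using desc same[OF xg] xg s tS by (simp add: assoc descent_iff)
      then have "len (g \<otimes> t) < len g" using snoc.prems(7)[of t] t by simp
      then show "len (g \<otimes> s \<otimes> t) < len (g \<otimes> s)"
        using same[OF g] g s tS by (simp add: descent_iff)
    qed (use snoc.prems(1-3) js g s in auto)
  qed
qed

text \<open>
  Here \<open>- v\<close> is dominant, so \<open>rep w v \<ge> v\<close> for all \<open>w\<close>, whereas the average of \<open>rep w v\<close> over the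
  group vanishes.
\<close>

lemma finite_no_subharmonic:
  assumes fin: "finite (carrier W)" and v: "supported v" "\<And>r. 0 \<le> v r"
    and sub: "\<And>s. s \<in> S \<Longrightarrow> 2 * v s \<le> (\<Sum>t\<in>S - {s}. bond m s t * v t)"
  shows "v = (\<lambda>r. 0)"
proof -
  define F where "F u = (\<Sum>w\<in>carrier W. \<Sum>r\<in>S. rep w u r)" for u
  have F_unit: "F (unit_vec s) = 0" if s: "s \<in> S" for s
  proof -
    \<comment> \<open>Reindexing by \<open>w \<otimes> s\<close> negates every summand, since
      \<open>s\<close> negates its own root.\<close>
    have "bij_betw (\<lambda>w. w \<otimes> s) (carrier W) (carrier W)"
      by (rule bij_betwI[where g = "\<lambda>w. w \<otimes> s"]) (use s in auto)
    then have "F (unit_vec s) = (\<Sum>w\<in>carrier W. \<Sum>r\<in>S. rep (w \<otimes> s) (unit_vec s) r)"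
      unfolding F_def by (rule sum.reindex_bij_betw[symmetric])
    also have "\<dots> = - F (unit_vec s)"
      using s by (simp add: F_def rep_mult_gen_unit_vec sum_negf cong: sum.cong)
    finally show ?thesis by simp
  qed
  have "F v = (\<Sum>w\<in>carrier W. \<Sum>r\<in>S. \<Sum>s\<in>S. v s * rep w (unit_vec s) r)"
    unfolding F_def by (simp add: rep_expand[OF v(1)])
  also have "\<dots> = (\<Sum>w\<in>carrier W. \<Sum>s\<in>S. \<Sum>r\<in>S. v s * rep w (unit_vec s) r)"
    by (intro sum.cong refl sum.swap)
  also have "\<dots> = (\<Sum>s\<in>S. v s * F (unit_vec s))"
    unfolding F_def sum_distrib_left by (rule sum.swap)
  finally have "F v = 0" using F_unit by simp
  have ge: "v r \<le> rep w v r" if "w \<in> carrier W" for w r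
    using that
  proof (induction "len w" arbitrary: w rule: less_induct)
    case less
    show ?case
    proof (cases "w = \<one>")
      case False
      then obtain s where s: "s \<in> S" and lt: "len (w \<otimes> s) < len w"
        using ex_descent less.prems by blast
      define d where "d = reflect s v s - v s"
      have "0 \<le> d" using sub[OF s] by (simp add: d_def reflect_def)
      have ws: "w \<otimes> s \<in> carrier W" using less.prems s by simp
      have "rep w v = rep (w \<otimes> s) (reflect s v)"
        using rep_mult[OF ws, of s v] less.prems s by (simp add: rep_gen)
      also have "\<dots> = rep (w \<otimes> s) (\<lambda>r. 1 * v r + d * unit_vec s r)"
        unfolding d_def by (rule arg_cong[OF reflect_diff])
      finally have "rep w v r = rep (w \<otimes> s) v r + d * rep (w \<otimes> s) (unit_vec s) r"
        by (simp add: rep_lincomb del: mult_1_left)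
      moreover have "0 \<le> rep (w \<otimes> s) (unit_vec s) r"
        using ws s lt less.prems by (intro rep_unit_vec_nonneg) auto
      ultimately show ?thesis
        using less.hyps[OF lt ws] \<open>0 \<le> d\<close> by (simp add: add_increasing2)
    qed simp
  qed
  have "(\<Sum>w\<in>carrier W. \<Sum>r\<in>S. v r) \<le> F v"
    unfolding F_def by (intro sum_mono ge)
  moreover have "card (carrier W) > 0"
    using fin by (auto simp: card_gt_0_iff)
  ultimately have "(\<Sum>r\<in>S. v r) \<le> 0"
    using \<open>F v = 0\<close> by (simp add: mult_le_0_iff)
  then have "(\<Sum>r\<in>S. v r) = 0"
    using sum_nonneg[of S v] v(2) by simp
  then have "\<forall>r\<in>S. v r = 0"
    using sum_nonneg_eq_0_iff[OF finite_S, of v] v(2) by simp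
  then show ?thesis using v(1) by (auto simp: supported_def)
qed

end

section \<open>Bipartite Coxeter elements\<close>

text \<open>The hypothesis \<open>leaf\<close> makes the graph a forest: every nonempty vertex set
  has a vertex with at most one neighbour in it. Such a vertex is removed and then put one level
  above or below its neighbour, as the orientation \<open>R\<close> demands.\<close>

lemma ex_height_function:
  fixes adj R :: "'a \<Rightarrow> 'a \<Rightarrow> bool"
  assumes "finite T"
    and sym: "\<And>x y. adj x y \<Longrightarrow> adj y x" and irrefl: "\<And>x. \<not> adj x x"
    and asym: "\<And>x y. R x y \<Longrightarrow> \<not> R y x"
    and leaf: "\<And>U. U \<subseteq> T \<Longrightarrow> U \<noteq> {} \<Longrightarrow>
      \<exists>p\<in>U. \<forall>x\<in>U. \<forall>y\<in>U. adj p x \<longrightarrow> adj p y \<longrightarrow> x = y"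
  shows "\<exists>\<eta> :: 'a \<Rightarrow> int. \<forall>x\<in>T. \<forall>y\<in>T. adj x y \<longrightarrow> R x y \<longrightarrow> \<eta> y = \<eta> x + 1"
  using assms(1) leaf
proof (induction T rule: finite_psubset_induct)
  case (psubset T)
  show ?case
  proof (cases "T = {}")
    case False
    then obtain p where p: "p \<in> T"
      and uniq: "\<And>x y. x \<in> T \<Longrightarrow> y \<in> T \<Longrightarrow> adj p x \<Longrightarrow> adj p y \<Longrightarrow> x = y"
      using psubset.prems[of T] by auto
    have "\<exists>\<eta> :: 'a \<Rightarrow> int. \<forall>x\<in>T - {p}. \<forall>y\<in>T - {p}. adj x y \<longrightarrow> R x y \<longrightarrow> \<eta> y = \<eta> x + 1"
      using p psubset.prems by (intro psubset.IH) auto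
    then obtain \<eta> :: "'a \<Rightarrow> int" where \<eta>:
      "\<And>x y. x \<in> T - {p} \<Longrightarrow> y \<in> T - {p} \<Longrightarrow> adj x y \<Longrightarrow> R x y \<Longrightarrow> \<eta> y = \<eta> x + 1"
      by auto
    show ?thesis
    proof (cases "\<exists>q\<in>T. adj p q")
      case True
      then obtain q where q: "q \<in> T" "adj p q" by auto
      then have "q \<noteq> p" using irrefl by auto
      define \<eta>' where "\<eta>' = \<eta>(p := if R q p then \<eta> q + 1 else \<eta> q - 1)"
      have "\<eta>' y = \<eta>' x + 1" if xy: "x \<in> T" "y \<in> T" "adj x y" "R x y" for x y
      proof (cases "x = p \<or> y = p")
        case True
        then show ?thesis
        proof
          assume "x = p"
          moreover from this have "y = q" using uniq[of y q] xy q by simp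
          ultimately show ?thesis using xy \<open>q \<noteq> p\<close> asym[of p q] by (simp add: \<eta>'_def)
        next
          assume "y = p"
          moreover from this have "x = q" using uniq[of x q] xy q sym[of x p] by simp
          ultimately show ?thesis using xy \<open>q \<noteq> p\<close> by (simp add: \<eta>'_def)
        qed
      qed (use \<eta> xy in \<open>simp add: \<eta>'_def\<close>)
      then show ?thesis by blast
    next
      case False
      then have "\<eta> y = \<eta> x + 1" if "x \<in> T" "y \<in> T" "adj x y" "R x y" for x y
        using that \<eta>[of x y] sym[of x y] by auto
      then show ?thesis by blast
    qed
  qed simp
qed

lemma sorted_wrt_cases:
  "sorted_wrt R xs \<Longrightarrow> x \<in> set xs \<Longrightarrow> y \<in> set xs \<Longrightarrow> x \<noteq> y \<Longrightarrow> R x y \<or> R y x"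
  by (induction xs) auto

lemma funpow_comp_rotate: "((g \<circ> f) ^^ n) (g x) = g (((f \<circ> g) ^^ n) x)"
  by (induction n) simp_all

context reflections
begin

definition adjacent :: "'a \<Rightarrow> 'a \<Rightarrow> bool" where
  "adjacent s t \<longleftrightarrow> s \<in> S \<and> t \<in> S \<and> s \<noteq> t \<and> a s t \<noteq> 0"

lemma adjacent_sym: "adjacent s t \<Longrightarrow> adjacent t s"
  using a_sym by (auto simp: adjacent_def)

definition independent :: "'a set \<Rightarrow> bool" where
  "independent A \<longleftrightarrow> (\<forall>s\<in>A. \<forall>t\<in>A. \<not> adjacent s t)"

lemma reflect_act_commute:
  assumes "x \<in> S" "\<And>y. y \<in> set ys \<Longrightarrow> y \<in> S \<and> x \<noteq> y \<and> \<not> adjacent x y"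
  shows "reflect x (act ys v) = act ys (reflect x v)"
  using assms(2)
proof (induction ys)
  case (Cons z ys)
  then have IH: "reflect x (act ys v) = act ys (reflect x v)" by simp
  have "reflect x (reflect z (act ys v)) = reflect z (reflect x (act ys v))"
    using assms(1) Cons.prems[of z] by (intro reflect_commute) (auto simp: adjacent_def)
  then show ?case using IH by simp
qed simp

text \<open>A letter with property \<open>Q\<close> commutes with the later letters lacking it, so
  it can travel to the right past them.\<close>

lemma act_partition:
  assumes "set xs \<subseteq> S"
    and "sorted_wrt (\<lambda>x y. Q x \<longrightarrow> \<not> Q y \<longrightarrow> \<not> adjacent x y) xs"
  shows "act xs v = act (filter (\<lambda>x. \<not> Q x) xs @ filter Q xs) v"
  using assms
proof (induction xs)
  case (Cons x xs)
  then have IH: "act xs v = act (filter (\<lambda>x. \<not> Q x) xs @ filter Q xs) v"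
    and x: "x \<in> S" by auto
  have "reflect x (act (filter (\<lambda>x. \<not> Q x) xs) u) = act (filter (\<lambda>x. \<not> Q x) xs) (reflect x u)"
    if "Q x" for u
    using that Cons.prems x by (intro reflect_act_commute) auto
  then show ?case using IH by auto
qed simp

text \<open>
  A Coxeter element with a height function \<open>\<eta>\<close> is conjugated into a bipartite one by moving its
  highest level to the front, which lowers the heights on that level by 2.
\<close>

lemma conjugate_to_bipartite:
  fixes \<eta> :: "'a \<Rightarrow> nat"
  assumes "distinct xs" "set xs = S"
    and "sorted_wrt (\<lambda>x y. adjacent x y \<longrightarrow> \<eta> y = \<eta> x + 1) xs"
    and "\<And>v. (act xs ^^ h) v = v"
  shows "\<exists>P M. distinct P \<and> distinct M \<and> set P \<union> set M = S \<and> set P \<inter> set M = {} \<and>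
    independent (set P) \<and> independent (set M) \<and> (\<forall>v. (act (P @ M) ^^ h) v = v)"
  using assms
proof (induction "\<Sum>s\<in>S. \<eta> s" arbitrary: xs \<eta> rule: less_induct)
  case less
  note dist = less.prems(1) and set = less.prems(2) and sorted = less.prems(3)
  have adj: "\<eta> y = \<eta> x + 1 \<or> \<eta> x = \<eta> y + 1" if "adjacent x y" for x y
    using sorted_wrt_cases[OF sorted, of x y] that adjacent_sym[OF that] set
    by (auto simp: adjacent_def)
  \<comment> \<open>A letter of maximal height has no neighbour after it, since that neighbour would
    be higher still; so the top level can be moved to the end.\<close>
  have part: "act xs = act (filter (\<lambda>x. \<eta> x \<noteq> k) xs @ filter (\<lambda>x. \<eta> x = k) xs)"
    if "\<And>s. s \<in> S \<Longrightarrow> \<eta> s \<le> k" for k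
  proof
    fix v
    have "sorted_wrt (\<lambda>x y. \<eta> x = k \<longrightarrow> \<not> \<eta> y = k \<longrightarrow> \<not> adjacent x y) xs"
      using sorted
    proof (rule sorted_wrt_mono_rel[rotated])
      fix x y assume "x \<in> set xs" "y \<in> set xs" "adjacent x y \<longrightarrow> \<eta> y = \<eta> x + 1"
      then show "\<eta> x = k \<longrightarrow> \<not> \<eta> y = k \<longrightarrow> \<not> adjacent x y"
        using that[of y] set by auto
    qed
    then show "act xs v = act (filter (\<lambda>x. \<eta> x \<noteq> k) xs @ filter (\<lambda>x. \<eta> x = k) xs) v"
      using set by (intro act_partition) auto
  qed
  show ?case
  proof (cases "\<forall>s\<in>S. \<eta> s \<le> 1")
    case True
    define P where "P = filter (\<lambda>x. \<eta> x \<noteq> 1) xs"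
    define M where "M = filter (\<lambda>x. \<eta> x = 1) xs"
    have "act xs = act (P @ M)"
      unfolding P_def M_def by (rule part) (use True in auto)
    moreover have "independent (set P)" "independent (set M)"
      unfolding independent_def P_def M_def using adj True set by fastforce+
    moreover have "distinct P" "distinct M" "set P \<union> set M = S" "set P \<inter> set M = {}"
      using dist set by (auto simp: P_def M_def)
    ultimately show ?thesis using less.prems(4) by metis
  next
    case False
    then have "S \<noteq> {}" by auto
    define k where "k = Max (\<eta> ` S)"
    have le_k: "\<eta> s \<le> k" if "s \<in> S" for s
      unfolding k_def using finite_S that by simp
    have "k \<in> \<eta> ` S" unfolding k_def using finite_S \<open>S \<noteq> {}\<close> by (intro Max_in) auto
    then obtain top where top: "top \<in> S" "\<eta> top = k" by auto
    obtain s where "s \<in> S" "\<not> \<eta> s \<le> 1" using False by auto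
    then have "2 \<le> k" using le_k[of s] by linarith
    define A where "A = filter (\<lambda>x. \<eta> x \<noteq> k) xs"
    define B where "B = filter (\<lambda>x. \<eta> x = k) xs"
    \<comment> \<open>Neighbours of the top level have height \<open>k - 1\<close>. Once the top
      level stands in front of them, its height must be one less than theirs.\<close>
    define \<eta>' where "\<eta>' x = (if \<eta> x = k then k - 2 else \<eta> x)" for x
    have act_xs: "act xs = act A \<circ> act B"
      using part[OF le_k] by (simp add: A_def B_def fun_eq_iff)
    have "(\<Sum>s\<in>S. \<eta>' s) < (\<Sum>s\<in>S. \<eta> s)"
      using top \<open>2 \<le> k\<close> finite_S by (intro sum_strict_mono_ex1) (auto simp: \<eta>'_def)
    moreover have "distinct (B @ A)" "set (B @ A) = S"
      using dist set by (auto simp: A_def B_def)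
    moreover have "sorted_wrt (\<lambda>x y. adjacent x y \<longrightarrow> \<eta>' y = \<eta>' x + 1) (B @ A)"
      unfolding sorted_wrt_append
    proof (intro conjI ballI)
      show "sorted_wrt (\<lambda>x y. adjacent x y \<longrightarrow> \<eta>' y = \<eta>' x + 1) B"
        using sorted_wrt_filter[OF sorted] unfolding B_def
        by (rule sorted_wrt_mono_rel[rotated]) (auto simp: \<eta>'_def)
      show "sorted_wrt (\<lambda>x y. adjacent x y \<longrightarrow> \<eta>' y = \<eta>' x + 1) A"
        using sorted_wrt_filter[OF sorted] unfolding A_def
        by (rule sorted_wrt_mono_rel[rotated]) (auto simp: \<eta>'_def)
      fix x y assume "x \<in> set B" "y \<in> set A"
      then have xy: "\<eta> x = k" "y \<in> S" "\<eta> y \<noteq> k" using set by (auto simp: A_def B_def)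
      show "adjacent x y \<longrightarrow> \<eta>' y = \<eta>' x + 1"
      proof
        assume "adjacent x y"
        then have "k = \<eta> y + 1" using adj[of x y] xy le_k[of y] by auto
        then show "\<eta>' y = \<eta>' x + 1" using xy \<open>2 \<le> k\<close> by (simp add: \<eta>'_def)
      qed
    qed
    moreover have "(act (B @ A) ^^ h) v = v" for v
    proof -
      have "act (B @ A) = act B \<circ> act A" by (simp add: fun_eq_iff)
      then have "(act (B @ A) ^^ h) (act B (act (rev B) v)) = act B ((act xs ^^ h) (act (rev B) v))"
        using funpow_comp_rotate[of h "act B" "act A" "act (rev B) v"] act_xs by simp
      then show ?thesis using less.prems(4) by simp
    qed
    ultimately show ?thesis by (rule less.hyps)
  qed
qed

text \<open>The order of the letters in \<open>xs\<close> orients the edges of the diagram; on a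
  forest there are heights that rise by one along this orientation.\<close>

lemma ex_bipartite:
  assumes "distinct xs" "set xs = S" "\<And>v. (act xs ^^ h) v = v"
    and leaf: "\<And>U. U \<subseteq> S \<Longrightarrow> U \<noteq> {} \<Longrightarrow>
      \<exists>p\<in>U. \<forall>x\<in>U. \<forall>y\<in>U. adjacent p x \<longrightarrow> adjacent p y \<longrightarrow> x = y"
  shows "\<exists>P M. distinct P \<and> distinct M \<and> set P \<union> set M = S \<and> set P \<inter> set M = {} \<and>
    independent (set P) \<and> independent (set M) \<and> (\<forall>v. (act (P @ M) ^^ h) v = v)"
proof -
  define R where "R x y \<longleftrightarrow> (\<exists>i j. i < j \<and> j < length xs \<and> xs ! i = x \<and> xs ! j = y)" for x y
  have "\<not> R y x" if Rxy: "R x y" for x y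
  proof
    assume "R y x"
    then obtain i j where "i < j" "j < length xs" "xs ! i = y" "xs ! j = x" unfolding R_def by auto
    moreover obtain i' j' where "i' < j'" "j' < length xs" "xs ! i' = x" "xs ! j' = y"
      using Rxy unfolding R_def by auto
    ultimately have "i = j'" "j = i'" using assms(1) by (auto simp: nth_eq_iff_index_eq)
    then show False using \<open>i < j\<close> \<open>i' < j'\<close> by simp
  qed
  then have "\<exists>\<eta> :: 'a \<Rightarrow> int. \<forall>x\<in>S. \<forall>y\<in>S. adjacent x y \<longrightarrow> R x y \<longrightarrow> \<eta> y = \<eta> x + 1"
    by (intro ex_height_function[OF finite_S adjacent_sym _ _ leaf]) (simp_all add: adjacent_def)
  then obtain \<eta> :: "'a \<Rightarrow> int" where \<eta>:
    "\<And>x y. x \<in> S \<Longrightarrow> y \<in> S \<Longrightarrow> adjacent x y \<Longrightarrow> R x y \<Longrightarrow> \<eta> y = \<eta> x + 1" by auto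
  \<comment> \<open>Shifting by the minimum gives natural numbers, whose sum is the induction
    measure of \<open>conjugate_to_bipartite\<close>.\<close>
  define \<eta>' where "\<eta>' x = nat (\<eta> x - Min (\<eta> ` S))" for x
  have min: "Min (\<eta> ` S) \<le> \<eta> x" if "x \<in> S" for x
    using finite_S that by simp
  have "sorted_wrt (\<lambda>x y. adjacent x y \<longrightarrow> \<eta>' y = \<eta>' x + 1) xs"
    unfolding sorted_wrt_iff_nth_less
  proof (intro allI impI)
    fix i j assume ij: "i < j" "j < length xs" and adj: "adjacent (xs ! i) (xs ! j)"
    have "xs ! i \<in> S" "xs ! j \<in> S" using adj by (auto simp: adjacent_def)
    moreover have "R (xs ! i) (xs ! j)" using ij by (auto simp: R_def)
    ultimately show "\<eta>' (xs ! j) = \<eta>' (xs ! i) + 1"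
      using \<eta>[OF _ _ adj] min[of "xs ! i"] by (simp add: \<eta>'_def nat_add_distrib)
  qed
  then show ?thesis by (rule conjugate_to_bipartite[OF assms(1,2) _ assms(3)])
qed

section \<open>The Perron--Frobenius vector and the Coxeter plane\<close>

text \<open>The maximiser of the quadratic form of the adjacency matrix on the nonnegative unit sphere.\<close>

lemma ex_perron_vector:
  assumes "S \<noteq> {}"
    and conn: "\<And>s t. s \<in> S \<Longrightarrow> t \<in> S \<Longrightarrow> adjacent\<^sup>*\<^sup>* s t"
  shows "\<exists>y \<mu>. (\<forall>s\<in>S. 0 < y s) \<and> (\<forall>s\<in>S. (\<Sum>t\<in>S - {s}. a s t * y t) = \<mu> * y s)"
proof -
  define n where "n s t = (if s = t then 0 else a s t)" for s t
  define A where "A y s = (\<Sum>t\<in>S. n s t * y t)" for y :: "'a \<Rightarrow> real" and s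
  define Q where "Q y = (\<Sum>s\<in>S. y s * A y s)" for y
  define N where "N y = (\<Sum>s\<in>S. (y s)\<^sup>2)" for y :: "'a \<Rightarrow> real"
  \<comment> \<open>Coordinates outside \<open>S\<close> are pinned to 0, so that the product over
    the whole type, finite or not, is compact by Tychonoff.\<close>
  define K where "K = PiE UNIV (\<lambda>i. if i \<in> S then {0..1 :: real} else {0}) \<inter> {y. N y = 1}"
  have n_sym: "n s t = n t s" and n_nonneg: "0 \<le> n s t" if "s \<in> S" "t \<in> S" for s t
    using a_sym a_nonneg that by (auto simp: n_def)
  have coord: "continuous_on B (\<lambda>y :: 'a \<Rightarrow> real. y i)" for B i
    by (rule continuous_on_subset[OF continuous_on_product_coordinates]) simp
  have "compact (PiE UNIV (\<lambda>i. if i \<in> S then {0..1 :: real} else {0}))"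
    unfolding compactin_euclidean_iff[symmetric] euclidean_product_topology[symmetric]
      compactin_PiE by auto
  moreover have "closed {y. N y = 1}"
    unfolding N_def by (intro closed_Collect_eq continuous_intros coord)
  ultimately have "compact K" unfolding K_def by (rule compact_Int_closed)
  obtain s0 where "s0 \<in> S" using assms(1) by auto
  have "N (unit_vec s0) = (\<Sum>s\<in>{s0}. (unit_vec s0 s)\<^sup>2)"
    unfolding N_def using \<open>s0 \<in> S\<close> finite_S
    by (intro sum.mono_neutral_right) (auto simp: unit_vec_def)
  then have "unit_vec s0 \<in> K"
    using \<open>s0 \<in> S\<close> by (auto simp: K_def unit_vec_def)
  then have "K \<noteq> {}" by auto
  moreover have "continuous_on K Q"
    unfolding Q_def A_def by (intro continuous_intros coord)
  ultimately obtain y where y: "y \<in> K" and max: "\<And>z. z \<in> K \<Longrightarrow> Q z \<le> Q y"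
    using continuous_attains_sup[OF \<open>compact K\<close>] by blast
  define \<mu> where "\<mu> = Q y"
  have y_coord: "y i \<in> (if i \<in> S then {0..1} else {0})" for i
    using y PiE_mem[of y UNIV "\<lambda>i. if i \<in> S then {0..1} else {0}" i] unfolding K_def by simp
  have y_nonneg: "0 \<le> y i" for i
    using y_coord[of i] by (auto split: if_splits)
  have y_outside: "y i = 0" if "i \<notin> S" for i
    using y_coord[of i] that by simp
  have "N y = 1" using y by (simp add: K_def)
  have "0 \<le> \<mu>"
    unfolding \<mu>_def Q_def A_def using y_nonneg n_nonneg by (intro sum_nonneg mult_nonneg_nonneg) auto
  have max': "Q z \<le> \<mu> * N z" if z: "\<And>i. 0 \<le> z i" "supported z" for z
  proof (cases "N z = 0")
    case True
    then have "z s = 0" if "s \<in> S" for s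
      using that sum_nonneg_eq_0_iff[OF finite_S, of "\<lambda>s. (z s)\<^sup>2"] by (simp add: N_def)
    then have "Q z = 0" by (simp add: Q_def)
    then show ?thesis using True by simp
  next
    case False
    moreover have "0 \<le> N z" by (simp add: N_def sum_nonneg)
    ultimately have pos: "0 < N z" by simp
    define c where "c = 1 / sqrt (N z)"
    have c: "0 < c" "c\<^sup>2 * N z = 1"
      using pos by (simp_all add: c_def power_divide)
    have Nc: "N (\<lambda>i. c * z i) = 1"
      using c by (simp add: N_def power_mult_distrib flip: sum_distrib_left)
    have "c * z i \<le> 1" if "i \<in> S" for i
    proof -
      have "(c * z i)\<^sup>2 \<le> N (\<lambda>i. c * z i)"
        unfolding N_def using finite_S that by (intro member_le_sum) auto
      then show ?thesis using Nc by (simp add: abs_square_le_1)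
    qed
    then have "(\<lambda>i. c * z i) \<in> K"
      using z c Nc by (auto simp: K_def supported_def)
    then have "Q (\<lambda>i. c * z i) \<le> \<mu>" unfolding \<mu>_def by (rule max)
    moreover have "Q (\<lambda>i. c * z i) = c\<^sup>2 * Q z"
      by (simp add: Q_def A_def sum_distrib_left power2_eq_square ac_simps)
    ultimately have "c\<^sup>2 * Q z \<le> c\<^sup>2 * (\<mu> * N z)" using c by (simp add: ac_simps)
    then show ?thesis using c by simp
  qed
  have le: "A y s \<le> \<mu> * y s" if s: "s \<in> S" for s
  proof (rule ccontr)
    assume "\<not> A y s \<le> \<mu> * y s"
    define d where "d = A y s - \<mu> * y s"
    \<comment> \<open>Raising coordinate \<open>s\<close> by \<open>e\<close> changes
      \<open>Q - \<mu> * N\<close> by \<open>e * (2 * d - \<mu> * e)\<close>, which is positive for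
      this \<open>e\<close>; the added 1 covers \<open>\<mu> = 0\<close>.\<close>
    define e where "e = d / (\<mu> + 1)"
    have "0 < d" using \<open>\<not> A y s \<le> \<mu> * y s\<close> by (simp add: d_def)
    then have "0 < e" "e * (\<mu> + 1) = d"
      using \<open>0 \<le> \<mu>\<close> by (simp_all add: e_def)
    then have "\<mu> * e < 2 * d" using \<open>0 < d\<close> by (simp add: algebra_simps)
    define z where "z i = y i + e * unit_vec s i" for i
    have delta: "(\<Sum>i\<in>S. g i * unit_vec s i) = g s" for g
    proof -
      have "(\<Sum>i\<in>S. g i * unit_vec s i) = (\<Sum>i\<in>{s}. g i * unit_vec s i)"
        using s finite_S by (intro sum.mono_neutral_right) (auto simp: unit_vec_def)
      then show ?thesis by simp
    qed
    have Az: "A z i = A y i + e * n i s" for i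
      using delta[of "\<lambda>t. e * n i t"] by (simp add: A_def z_def algebra_simps sum.distrib)
    have sym: "(\<Sum>i\<in>S. y i * n i s) = A y s"
      unfolding A_def using n_sym s by (intro sum.cong) auto
    have "Q z = (\<Sum>i\<in>S. y i * A y i) + e * (\<Sum>i\<in>S. y i * n i s)
        + (\<Sum>i\<in>S. (e * A y i + e\<^sup>2 * n i s) * unit_vec s i)"
      by (simp add: Q_def Az z_def algebra_simps sum.distrib sum_distrib_left power2_eq_square)
    also have "\<dots> = \<mu> + 2 * e * A y s"
      unfolding delta sym by (simp add: \<mu>_def Q_def n_def)
    finally have Qz: "Q z = \<mu> + 2 * e * A y s" .
    have sq: "(unit_vec s i)\<^sup>2 = unit_vec s i" for i by (simp add: unit_vec_def)
    have "N z = N y + (\<Sum>i\<in>S. (2 * e * y i + e\<^sup>2) * unit_vec s i)"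
      by (simp add: N_def z_def power2_sum power_mult_distrib sq algebra_simps sum.distrib)
    then have Nz: "N z = 1 + 2 * e * y s + e\<^sup>2"
      using delta[of "\<lambda>i. 2 * e * y i + e\<^sup>2"] \<open>N y = 1\<close> by simp
    have "Q z \<le> \<mu> * N z"
    proof (rule max')
      show "0 \<le> z i" for i using y_nonneg[of i] \<open>0 < e\<close> by (simp add: z_def unit_vec_nonneg)
      show "supported z"
        using y_outside s by (auto simp: supported_def z_def unit_vec_def)
    qed
    then have "e * (2 * d) \<le> e * (\<mu> * e)"
      unfolding Qz Nz d_def by (simp add: algebra_simps power2_eq_square)
    then show False using \<open>0 < e\<close> \<open>\<mu> * e < 2 * d\<close> by simp
  qed
  \<comment> \<open>The nonnegative gaps, weighted by \<open>y\<close>, add up to zero, so the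
    eigenvalue equation can fail only where \<open>y\<close> vanishes; connectedness excludes such
    places.\<close>
  have "(\<Sum>s\<in>S. y s * (\<mu> * y s - A y s)) = \<mu> * N y - Q y"
    by (simp add: N_def Q_def algebra_simps sum_subtractf sum_distrib_left power2_eq_square)
  then have sum0: "(\<Sum>s\<in>S. y s * (\<mu> * y s - A y s)) = 0"
    using \<open>N y = 1\<close> by (simp add: \<mu>_def)
  have eq_or: "y s = 0 \<or> A y s = \<mu> * y s" if "s \<in> S" for s
    using that sum0 le y_nonneg
      sum_nonneg_eq_0_iff[OF finite_S, of "\<lambda>s. y s * (\<mu> * y s - A y s)"] by auto
  have spread: "y t = 0" if "y s = 0" "adjacent s t" for s t
  proof -
    have st: "s \<in> S" "t \<in> S" "s \<noteq> t" "a s t \<noteq> 0" using that(2) by (auto simp: adjacent_def)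
    have nonneg: "\<And>r. r \<in> S \<Longrightarrow> 0 \<le> n s r * y r" using st n_nonneg y_nonneg by simp
    then have "0 \<le> A y s" unfolding A_def by (rule sum_nonneg)
    then have "A y s = 0" using le[OF st(1)] that(1) by simp
    then have "n s t * y t = 0"
      using sum_nonneg_eq_0_iff[OF finite_S nonneg] st(2) by (simp add: A_def)
    then show ?thesis using st by (simp add: n_def)
  qed
  have pos: "0 < y s" if s: "s \<in> S" for s
  proof (rule ccontr)
    assume "\<not> 0 < y s"
    then have "y s = 0" using y_nonneg[of s] by simp
    have "y t = 0" if "t \<in> S" for t
      using conn[OF s that] by (induction rule: rtranclp_induct) (use \<open>y s = 0\<close> spread in auto)
    then have "N y = 0" by (simp add: N_def)
    then show False using \<open>N y = 1\<close> by simp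
  qed
  have "(\<Sum>t\<in>S - {s}. a s t * y t) = \<mu> * y s" if s: "s \<in> S" for s
  proof -
    have "A y s = (\<Sum>t\<in>S - {s}. a s t * y t)"
      unfolding A_def using finite_S s
      by (subst sum.remove[OF _ s]) (auto simp: n_def intro!: sum.cong split: if_splits)
    then show ?thesis using eq_or[OF s] pos[OF s] by simp
  qed
  then show ?thesis using pos by blast
qed

section \<open>The action on the Coxeter plane\<close>

lemma act_independent:
  assumes "distinct P" "set P \<subseteq> S" "independent (set P)"
  shows "act P v r = (if r \<in> set P then (\<Sum>t\<in>S - {r}. a r t * v t) - v r else v r)"
  using assms
proof (induction P arbitrary: r)
  case (Cons x P)
  have IH: "act P v q = (if q \<in> set P then (\<Sum>t\<in>S - {q}. a q t * v t) - v q else v q)" for q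
    using Cons.prems by (intro Cons.IH) (auto simp: independent_def)
  have "a x t = 0" if "t \<in> set P" for t
    using that Cons.prems by (auto simp: independent_def adjacent_def)
  then have "(\<Sum>t\<in>S - {x}. a x t * act P v t) = (\<Sum>t\<in>S - {x}. a x t * v t)"
    by (intro sum.cong) (auto simp: IH)
  then show ?case using Cons.prems(1) IH by (auto simp: reflect_def)
qed simp

text \<open>The plane appears dually: this is the linear functional with coordinates
  \<open>p\<close> and \<open>q\<close> with respect to the two halves of \<open>y\<close>.\<close>

definition plane :: "('a \<Rightarrow> real) \<Rightarrow> 'a list \<Rightarrow> 'a list \<Rightarrow> real \<Rightarrow> real \<Rightarrow> ('a \<Rightarrow> real) \<Rightarrow> real" where
  "plane y P M p q v = p * (\<Sum>s\<in>set P. y s * v s) + q * (\<Sum>s\<in>set M. y s * v s)"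

lemma plane_swap: "plane y P M p q v = plane y M P q p v"
  by (simp add: plane_def)

text \<open>The reflections in \<open>P\<close> do not see each other's coordinates, and by the
  eigenvalue equation they act on \<open>(p, q)\<close> as a plane reflection. \<open>P\<close> and
  \<open>M\<close> are swapped on the right so that the next factor of the word is again listed
  first.\<close>

lemma plane_act:
  assumes P: "distinct P" "independent (set P)" and M: "independent (set M)"
    and S: "set P \<union> set M = S" "set P \<inter> set M = {}"
    and eig: "\<And>s. s \<in> S \<Longrightarrow> (\<Sum>t\<in>S - {s}. a s t * y t) = \<mu> * y s"
  shows "plane y P M p q (act P v) = plane y M P (\<mu> * p + q) (- p) v"
proof -
  have PS: "set P \<subseteq> S" and MS: "set M \<subseteq> S" using S by auto
  have sum_P: "(\<Sum>t\<in>S - {s}. a s t * v t) = (\<Sum>t\<in>set M. a s t * v t)" if s: "s \<in> set P" for s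
    using s P(2) S finite_S
    by (intro sum.mono_neutral_right) (auto simp: independent_def adjacent_def)
  have sum_M: "(\<Sum>s\<in>set P. a s t * y s) = \<mu> * y t" if t: "t \<in> set M" for t
  proof -
    have "(\<Sum>s\<in>S - {t}. a t s * y s) = (\<Sum>s\<in>set P. a t s * y s)"
      using t M S finite_S
      by (intro sum.mono_neutral_right) (auto simp: independent_def adjacent_def)
    also have "\<dots> = (\<Sum>s\<in>set P. a s t * y s)"
      using t PS MS a_sym by (intro sum.cong) auto
    finally show ?thesis using eig[of t] t MS by auto
  qed
  have "(\<Sum>s\<in>set P. y s * act P v s)
      = (\<Sum>s\<in>set P. y s * ((\<Sum>t\<in>set M. a s t * v t) - v s))"
    by (intro sum.cong) (auto simp: act_independent[OF P(1) PS P(2)] sum_P)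
  also have "\<dots> = (\<Sum>s\<in>set P. \<Sum>t\<in>set M. (a s t * y s) * v t) - (\<Sum>s\<in>set P. y s * v s)"
    by (simp add: algebra_simps sum_subtractf sum_distrib_left)
  also have "(\<Sum>s\<in>set P. \<Sum>t\<in>set M. (a s t * y s) * v t) = (\<Sum>t\<in>set M. (\<Sum>s\<in>set P. a s t * y s) * v t)"
    by (subst sum.swap) (simp add: sum_distrib_right)
  also have "\<dots> = \<mu> * (\<Sum>t\<in>set M. y t * v t)"
    by (simp add: sum_M sum_distrib_left mult.assoc)
  finally have 1: "(\<Sum>s\<in>set P. y s * act P v s)
    = \<mu> * (\<Sum>t\<in>set M. y t * v t) - (\<Sum>s\<in>set P. y s * v s)" .
  have 2: "(\<Sum>s\<in>set M. y s * act P v s) = (\<Sum>s\<in>set M. y s * v s)"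
    using S(2) by (intro sum.cong) (auto simp: act_independent[OF P(1) PS P(2)])
  show ?thesis
    unfolding plane_def 1 2 by (simp add: algebra_simps)
qed

fun blocks :: "nat \<Rightarrow> 'a list \<Rightarrow> 'a list \<Rightarrow> 'a list" where
  "blocks 0 P M = []"
| "blocks (Suc k) P M = P @ blocks k M P"

lemma blocks_Suc_right: "blocks (Suc k) P M = blocks k P M @ (if even k then P else M)"
  by (induction k arbitrary: P M) simp_all

lemma blocks_in_lists: "P \<in> lists A \<Longrightarrow> M \<in> lists A \<Longrightarrow> blocks k P M \<in> lists A"
  by (induction k P M rule: blocks.induct) simp_all

lemma act_blocks_double: "act (blocks (2 * k) P M) v = (act (P @ M) ^^ k) v"
  by (induction k) simp_all

lemma blocks_add: "\<exists>xs. blocks (k + j) P M = blocks k P M @ xs"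
  by (induction k P M rule: blocks.induct) auto

text \<open>With coefficients \<open>x (i + 1)\<close> and \<open>- x i\<close>, one factor only
  shifts the index by one.\<close>

lemma plane_blocks:
  fixes x :: "nat \<Rightarrow> real"
  assumes "distinct P" "independent (set P)" "distinct M" "independent (set M)"
    and "set P \<union> set M = S" "set P \<inter> set M = {}"
    and eig: "\<And>s. s \<in> S \<Longrightarrow> (\<Sum>t\<in>S - {s}. a s t * y t) = \<mu> * y s"
    and rec: "\<And>i. x (i + 2) = \<mu> * x (i + 1) - x i"
  shows "plane y P M (x (i + 1)) (- x i) (act (blocks k P M) v)
    = (if even k then plane y P M (x (i + k + 1)) (- x (i + k)) v
       else plane y M P (x (i + k + 1)) (- x (i + k)) v)"
  using assms
proof (induction k arbitrary: P M i)
  case (Suc k)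
  have "plane y P M (x (i + 1)) (- x i) (act (blocks (Suc k) P M) v)
      = plane y M P (x (Suc i + 1)) (- x (Suc i)) (act (blocks k M P) v)"
    using plane_act[OF Suc.prems(1,2,4,5,6) eig, of "x (i + 1)" "- x i" "act (blocks k M P) v"]
      rec[of i] by simp
  also have "\<dots> = (if even k then plane y M P (x (Suc i + k + 1)) (- x (Suc i + k)) v
       else plane y P M (x (Suc i + k + 1)) (- x (Suc i + k)) v)"
    using Suc.prems by (intro Suc.IH) auto
  finally show ?case by simp
qed simp

end

section \<open>Compulsive maps\<close>

lemma sin_half_recurrence:
  "sin ((real (i + 2) - 1 / 2) * \<theta>)
    = 2 * cos \<theta> * sin ((real (i + 1) - 1 / 2) * \<theta>) - sin ((real i - 1 / 2) * \<theta>)"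
proof -
  have e: "(real (i + 2) - 1 / 2) * \<theta> = (real (i + 1) - 1 / 2) * \<theta> + \<theta>"
    "(real i - 1 / 2) * \<theta> = (real (i + 1) - 1 / 2) * \<theta> - \<theta>"
    by (simp_all add: algebra_simps)
  show ?thesis unfolding e sin_add sin_diff by (simp add: algebra_simps)
qed

lemma ecard_forward_orbit_le:
  assumes f: "(f ^^ n) w = z" "f z = z"
  shows "ecard (forward_orbit f w) \<le> enat (Suc n)"
proof -
  have fix_z: "(f ^^ k) z = z" for k
    using f(2) by (induction k) auto
  have "forward_orbit f w \<subseteq> (\<lambda>k. (f ^^ k) w) ` {..n}"
  proof
    fix x assume "x \<in> forward_orbit f w"
    then obtain k where k: "x = (f ^^ k) w" by (auto simp: forward_orbit_def)
    show "x \<in> (\<lambda>k. (f ^^ k) w) ` {..n}"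
    proof (cases "k \<le> n")
      case True
      then show ?thesis using k by auto
    next
      case False
      then have "(f ^^ k) w = (f ^^ (k - n)) ((f ^^ n) w)"
        by (simp add: funpow_add[symmetric, THEN fun_cong, simplified comp_def])
      then have "x = (f ^^ n) w" using k f(1) fix_z by simp
      then show ?thesis by blast
    qed
  qed
  moreover have "finite ((\<lambda>k. (f ^^ k) w) ` {..n})" by simp
  ultimately have "finite (forward_orbit f w)"
    "card (forward_orbit f w) \<le> card ((\<lambda>k. (f ^^ k) w) ` {..n})"
    by (auto intro: finite_subset card_mono)
  moreover have "card ((\<lambda>k. (f ^^ k) w) ` {..n}) \<le> Suc n"
    using card_image_le[of "{..n}" "\<lambda>k. (f ^^ k) w"] by simp
  ultimately show ?thesis by (simp add: ecard_def)
qed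

context finite_rank_coxeter
begin

section \<open>Bond values and leaves of the diagram\<close>

lemma bond_eq_0_or_ge_1:
  assumes st: "s \<in> S" "t \<in> S" "s \<noteq> t"
  shows "if 3 \<le> m s t then 1 \<le> bond m s t else bond m s t = 0"
proof (cases "m s t")
  case (enat k)
  have "2 \<le> k" by (rule m_ge_2[OF st enat])
  show ?thesis
  proof (cases "k = 2")
    case True
    then show ?thesis using enat by (simp add: bond_def numeral_eq_enat)
  next
    case False
    then have "3 \<le> k" using \<open>2 \<le> k\<close> by simp
    then have "cos (pi / 3) \<le> cos (pi / real k)"
      by (intro cos_monotone_0_pi_le divide_left_mono) auto
    then show ?thesis using enat \<open>3 \<le> k\<close> by (simp add: bond_def numeral_eq_enat cos_60)
  qed
qed (simp add: bond_def)

text \<open>If every vertex of \<open>U\<close> had two neighbours in \<open>U\<close>, each bond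
  being at least 1, the indicator of \<open>U\<close> would satisfy the inequality of
  \<open>finite_no_subharmonic\<close>.\<close>

lemma finite_ex_leaf:
  assumes fin: "finite (carrier W)" and U: "U \<subseteq> S" "U \<noteq> {}"
  shows "\<exists>p\<in>U. \<forall>x\<in>U. \<forall>y\<in>U. adjacent p x \<longrightarrow> adjacent p y \<longrightarrow> x = y"
proof (rule ccontr)
  assume neg: "\<not> ?thesis"
  define v :: "'a \<Rightarrow> real" where "v r = of_bool (r \<in> U)" for r
  have nonneg: "0 \<le> bond m s t * v t" if "s \<in> S" "t \<in> S - {s}" for s t
    using a_nonneg[of s t] that by (auto simp: v_def)
  have "2 * v s \<le> (\<Sum>t\<in>S - {s}. bond m s t * v t)" if s: "s \<in> S" for s
  proof (cases "s \<in> U")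
    case True
    then obtain x y where xy: "x \<in> U" "y \<in> U" "adjacent s x" "adjacent s y" "x \<noteq> y"
      using neg by blast
    then have "1 \<le> bond m s x" "1 \<le> bond m s y"
      using bond_eq_0_or_ge_1[of s x] bond_eq_0_or_ge_1[of s y]
      by (auto simp: adjacent_def split: if_splits)
    then have "2 * v s \<le> (\<Sum>t\<in>{x, y}. bond m s t * v t)"
      using xy True by (simp add: v_def)
    also have "\<dots> \<le> (\<Sum>t\<in>S - {s}. bond m s t * v t)"
      using xy finite_S nonneg[OF s] by (intro sum_mono2) (auto simp: adjacent_def)
    finally show ?thesis .
  next
    case False
    then have "v s = 0" by (simp add: v_def)
    then show ?thesis using sum_nonneg[of "S - {s}", OF nonneg[OF s]] by simp
  qed
  then have "v = (\<lambda>r. 0)"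
    using U by (intro finite_no_subharmonic[OF fin]) (auto simp: supported_def v_def)
  then show False using U by (auto simp: v_def fun_eq_iff)
qed

section \<open>Angles in the Coxeter plane and the order of a Coxeter element\<close>

lemma plane_nonpos:
  assumes "\<And>s. s \<in> set P \<union> set M \<Longrightarrow> 0 \<le> y s" "\<And>s. 0 \<le> v s" "p \<le> 0" "q \<le> 0"
  shows "plane y P M p q v \<le> 0"
  unfolding plane_def using assms
  by (intro add_nonpos_nonpos mult_nonpos_nonneg sum_nonneg mult_nonneg_nonneg) auto

lemma plane_unit_vec:
  assumes "s \<in> set P" "s \<notin> set M"
  shows "plane y P M p q (unit_vec s) = p * y s"
proof -
  have "(\<Sum>r\<in>set P. y r * unit_vec s r) = (\<Sum>r\<in>{s}. y r * unit_vec s r)"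
    using assms by (intro sum.mono_neutral_right) (auto simp: unit_vec_def)
  moreover have "(\<Sum>r\<in>set M. y r * unit_vec s r) = 0"
    using assms by (intro sum.neutral) (auto simp: unit_vec_def)
  ultimately show ?thesis by (simp add: plane_def)
qed

text \<open>
  In the plane the word moves the bisector of the fundamental chamber by steps of angle \<open>\<theta>\<close>, so
  that after about \<open>\<pi> / \<theta>\<close> of them it lies in the antipodal chamber.
\<close>

lemma blocks_all_descents:
  assumes P: "distinct P" "independent (set P)" and M: "distinct M" "independent (set M)"
    and S: "set P \<union> set M = S" "set P \<inter> set M = {}"
    and y: "\<And>s. s \<in> S \<Longrightarrow> 0 < y s"
    and eig: "\<And>s. s \<in> S \<Longrightarrow> (\<Sum>t\<in>S - {s}. bond m s t * y t) = 2 * cos \<theta> * y s"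
    and \<theta>: "0 < \<theta>" "\<theta> \<le> pi / 2"
    and k: "pi \<le> (real k + 1 / 2) * \<theta>" "(real k - 1 / 2) * \<theta> \<le> pi"
    and s: "s \<in> S"
  shows "len (word_prod W (blocks k P M) \<otimes> s) < len (word_prod W (blocks k P M))"
proof (rule ccontr)
  let ?w = "word_prod W (blocks k P M)"
  assume neg: "\<not> len (?w \<otimes> s) < len ?w"
  have lists: "blocks k P M \<in> lists S"
    using S by (intro blocks_in_lists) auto
  then have w: "?w \<in> carrier W" by simp
  define v where "v = rep ?w (unit_vec s)"
  have v_eq: "v = act (blocks k P M) (unit_vec s)"
    using lists by (simp add: v_def rep_word_prod)
  have v_nonneg: "0 \<le> v r" for r
    unfolding v_def by (rule rep_unit_vec_nonneg[OF w s]) (use neg in simp)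
  \<comment> \<open>The half step makes \<open>x 1 = - x 0\<close>, so the initial functional is a
    multiple of the sum with weights \<open>y\<close>, the bisector of the chamber.\<close>
  define x where "x i = sin ((real i - 1 / 2) * \<theta>)" for i :: nat
  have half: "0 < sin (\<theta> / 2)"
    using \<theta> by (intro sin_gt_zero) auto
  have x01: "x 1 = sin (\<theta> / 2)" "x 0 = - sin (\<theta> / 2)"
    by (simp_all add: x_def)
  have "k \<noteq> 0" using k(1) \<theta> by (cases k) auto
  have "(real k + 1 / 2) * \<theta> = (real k - 1 / 2) * \<theta> + \<theta>"
    by (simp add: algebra_simps)
  then have "(real k + 1 / 2) * \<theta> < 2 * pi"
    using k(2) \<theta>(2) pi_gt_zero by linarith
  then have "sin ((real k + 1 / 2) * \<theta>) \<le> 0"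
    by (rule sin_le_zero[OF k(1)])
  moreover have "real (k + 1) - 1 / 2 = real k + 1 / 2" by simp
  ultimately have "x (k + 1) \<le> 0"
    unfolding x_def by metis
  moreover have "0 \<le> x k"
    unfolding x_def using k(2) \<theta> \<open>k \<noteq> 0\<close> by (intro sin_ge_zero mult_nonneg_nonneg) auto
  moreover have "plane y P M (x (0 + 1)) (- x 0) v =
    (if even k then plane y P M (x (0 + k + 1)) (- x (0 + k)) (unit_vec s)
     else plane y M P (x (0 + k + 1)) (- x (0 + k)) (unit_vec s))"
    unfolding v_eq
    using sin_half_recurrence[of _ \<theta>]
    by (intro plane_blocks[OF P M S eig]) (simp_all add: x_def)
  \<comment> \<open>By the choice of \<open>k\<close> both coefficients \<open>x (k + 1)\<close> and
    \<open>- x k\<close> are nonpositive, while a nonnegative \<open>v\<close> has a nonnegative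
    weighted sum; so \<open>v\<close> is 0, which no root is.\<close>
  ultimately have "plane y P M (x 1) (- x 0) v \<le> 0"
    using y S by (auto intro!: plane_nonpos simp: unit_vec_nonneg less_imp_le)
  moreover have "plane y P M (x 1) (- x 0) v = sin (\<theta> / 2) * (\<Sum>r\<in>S. y r * v r)"
    unfolding S(1)[symmetric] using S(2)
    by (subst sum.union_disjoint) (auto simp: plane_def x01[simplified] algebra_simps)
  ultimately have "(\<Sum>r\<in>S. y r * v r) \<le> 0"
    using half by (simp add: mult_le_0_iff)
  moreover have nonneg: "0 \<le> y r * v r" if "r \<in> S" for r
    using y[OF that] v_nonneg[of r] by simp
  ultimately have "(\<Sum>r\<in>S. y r * v r) = 0"
    using sum_nonneg[of S "\<lambda>r. y r * v r"] by simp
  then have "y r * v r = 0" if "r \<in> S" for r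
    using sum_nonneg_eq_0_iff[OF finite_S, of "\<lambda>r. y r * v r"] nonneg that by simp
  then have "v r = 0" if "r \<in> S" for r
    using y that by fastforce
  moreover have "supported v"
    unfolding v_def by (intro supported_rep w supported_unit_vec s)
  ultimately have "v r = 0" for r by (cases "r \<in> S") (auto simp: supported_def)
  then show False using rep_unit_vec_nonzero[OF w, of s] by (simp add: v_def)
qed

text \<open>\<open>P M\<close> rotates the plane by \<open>2 * \<theta>\<close>, so if its
  \<open>h\<close>-th power is the identity, \<open>2 * h * \<theta>\<close> is a positive multiple
  of \<open>2 * pi\<close>. When \<open>P\<close> or \<open>M\<close> is empty there is no plane;
  then \<open>\<theta> = pi / 2\<close>, and \<open>h = 1\<close> is impossible since a simple root
  is negated.\<close>

lemma pi_le_order_mult_angle: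
  assumes P: "distinct P" "independent (set P)" and M: "distinct M" "independent (set M)"
    and S: "set P \<union> set M = S" "set P \<inter> set M = {}" "S \<noteq> {}"
    and y: "\<And>s. s \<in> S \<Longrightarrow> 0 < y s"
    and eig: "\<And>s. s \<in> S \<Longrightarrow> (\<Sum>t\<in>S - {s}. bond m s t * y t) = 2 * cos \<theta> * y s"
    and \<theta>: "0 < \<theta>" "\<theta> \<le> pi / 2"
    and h: "0 < h" "\<And>v. (act (P @ M) ^^ h) v = v"
  shows "pi \<le> real h * \<theta>"
proof (cases "P \<noteq> [] \<and> M \<noteq> []")
  case True
  then obtain s t where st: "s \<in> set P" "t \<in> set M"
    by (meson list.set_intros(1) neq_Nil_conv last_in_set)
  define x where "x i = sin ((real i - 1 / 2) * \<theta>)" for i :: nat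
  have plane: "plane y P M (x (0 + 1)) (- x 0) v = plane y P M (x (0 + 2 * h + 1)) (- x (0 + 2 * h)) v" for v
    using plane_blocks[OF P M S(1,2) eig, of x 0 "2 * h" v] sin_half_recurrence[of _ \<theta>]
    by (simp add: x_def act_blocks_double h(2))
  have notin: "s \<notin> set M" "t \<notin> set P" using st S(2) by auto
  \<comment> \<open>Evaluating at a simple root from either half reads off one coordinate of the
    functional.\<close>
  have "x 1 * y s = x (2 * h + 1) * y s"
    using plane[of "unit_vec s"] plane_unit_vec[OF st(1) notin(1)] by simp
  moreover have "x 0 * y t = x (2 * h) * y t"
    using plane[of "unit_vec t"] plane_unit_vec[OF st(2) notin(2)]
    by (simp add: plane_swap[of y P M])
  moreover have "y s \<noteq> 0" "y t \<noteq> 0" using y[of s] y[of t] st S(1) by auto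
  ultimately have x: "x (2 * h + 1) = x 1" "x (2 * h) = x 0" by simp_all
  define \<phi> where "\<phi> = real (2 * h) * \<theta>"
  have e: "(real (2 * h + 1) - 1 / 2) * \<theta> = \<phi> + \<theta> / 2" "(real (2 * h) - 1 / 2) * \<theta> = \<phi> - \<theta> / 2"
    by (simp_all add: \<phi>_def algebra_simps)
  have "sin (\<phi> + \<theta> / 2) = sin (\<theta> / 2)" "sin (\<phi> - \<theta> / 2) = - sin (\<theta> / 2)"
    using x unfolding x_def e by simp_all
  then have "cos \<phi> * sin (\<theta> / 2) = 1 * sin (\<theta> / 2)"
    unfolding sin_add sin_diff by linarith
  moreover have "sin (\<theta> / 2) > 0" using \<theta> by (intro sin_gt_zero) auto
  ultimately have "cos \<phi> = 1" by simp
  then obtain n :: int where "\<phi> = of_int n * 2 * pi" unfolding cos_one_2pi_int by auto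
  moreover have "0 < \<phi>" using h(1) \<theta>(1) by (simp add: \<phi>_def)
  ultimately have "1 \<le> n" by (simp add: zero_less_mult_iff)
  then have "1 * (2 * pi) \<le> of_int n * (2 * pi)" by (intro mult_right_mono) auto
  then have "2 * pi \<le> \<phi>" using \<open>\<phi> = of_int n * 2 * pi\<close> by simp
  then show ?thesis by (simp add: \<phi>_def)
next
  case False
  then have PM: "distinct (P @ M)" "independent (set (P @ M))" "set (P @ M) = S"
    using P M S by auto
  then have zero: "bond m s t = 0" if "s \<in> S" "t \<in> S" "s \<noteq> t" for s t
    using that by (auto simp: independent_def adjacent_def)
  obtain s where s: "s \<in> S" using S(3) by auto
  have sum0: "(\<Sum>t\<in>S - {s}. bond m s t * v t) = 0" for v
    using zero[OF s] by (intro sum.neutral) auto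
  then have "cos \<theta> = 0" using eig[OF s] y[OF s] by simp
  then have "\<theta> = pi / 2" using cos_gt_zero[of \<theta>] \<theta> by force
  have "act (P @ M) (unit_vec s) s = - 1"
    using s PM(3) sum0 by (subst act_independent[OF PM(1) _ PM(2)]) auto
  then have "act (P @ M) (unit_vec s) \<noteq> unit_vec s"
    by (metis one_neq_neg_one unit_vec_self)
  then have "h \<noteq> 1" using h(2)[of "unit_vec s"] by auto
  then have "2 \<le> h" using h(1) by simp
  then have "2 * \<theta> \<le> real h * \<theta>" using \<theta>(1) by (intro mult_right_mono) auto
  then show ?thesis using \<open>\<theta> = pi / 2\<close> by linarith
qed

text \<open>Put \<open>g = inv (f w) \<otimes> w\<close>. The two conditions on \<open>f\<close> say
  that lengths add in \<open>w = f w \<otimes> g\<close> and that every descent \<open>s\<close> of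
  \<open>w\<close> shortens \<open>g\<close>, by
  \<open>len (w \<otimes> s) - len (f w) < len w - len (f w)\<close>. This is what
  \<open>subwords_strip_block\<close> asks for.\<close>

lemma compulsive_subwords:
  assumes f: "compulsive W S f" and xs: "xs \<in> lists S"
    and js: "js \<in> lists S" "distinct js" "independent (set js)"
    and w: "w \<in> subwords (xs @ js)"
  shows "f w \<in> subwords xs"
proof -
  have "xs @ js \<in> lists S" using xs js by auto
  then have wc: "w \<in> carrier W" using w subwords_subset_carrier by blast
  have fw: "f w \<in> carrier W" using f wc by (auto simp: compulsive_def)
  have le: "int (len (inv (f w) \<otimes> w)) = int (len w) - int (len (f w))"
    using f wc by (auto simp: compulsive_def right_weak_le_def)
  have le_s: "int (len (inv (f w) \<otimes> (w \<otimes> s))) = int (len (w \<otimes> s)) - int (len (f w))"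
    if "s \<in> S" "len (w \<otimes> s) < len w" for s
    using f wc that by (auto simp: compulsive_def right_weak_le_def right_descents_def)
  have eq: "f w \<otimes> (inv (f w) \<otimes> w) = w"
    using fw wc by (simp add: m_assoc[symmetric])
  show ?thesis
  proof (rule subwords_strip_block[OF xs fw js(1,2), of "inv (f w) \<otimes> w"], goal_cases)
    case (1 s t)
    then show ?case using js by (auto simp: independent_def adjacent_def)
  next
    case (5 s)
    have "s \<in> S" using 5 js by auto
    then have "inv (f w) \<otimes> w \<otimes> s = inv (f w) \<otimes> (w \<otimes> s)" using fw wc by (simp add: m_assoc)
    then show ?case using 5 le le_s[OF \<open>s \<in> S\<close>] by (simp add: eq)
  qed (use fw wc le w eq in simp_all)
qed

text \<open>Factors are stripped from the right end, so the word always begins with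
  \<open>P\<close>, whichever factor is last.\<close>

lemma compulsive_iterate:
  assumes f: "compulsive W S f"
    and P: "P \<in> lists S" "distinct P" "independent (set P)"
    and M: "M \<in> lists S" "distinct M" "independent (set M)"
    and w: "w \<in> subwords (blocks (i + j) P M)"
  shows "(f ^^ i) w \<in> subwords (blocks j P M)"
  using w
proof (induction i arbitrary: j)
  case (Suc i)
  then have "(f ^^ i) w \<in> subwords (blocks (Suc j) P M)"
    by (simp del: blocks.simps)
  then have "f ((f ^^ i) w) \<in> subwords (blocks j P M)"
    unfolding blocks_Suc_right
    by (rule compulsive_subwords[OF f blocks_in_lists[OF P(1) M(1)], rotated -1])
      (use P M in auto)
  then show ?case by simp
qed simp

text \<open>In the integers, \<open>f \<one>\<close> lying below \<open>\<one>\<close> equates a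
  length with \<open>- len (f \<one>)\<close>.\<close>

lemma compulsive_one:
  assumes "compulsive W S f"
  shows "f \<one> = \<one>"
proof -
  have f1: "f \<one> \<in> carrier W" using assms by (auto simp: compulsive_def)
  have "int (len (inv (f \<one>) \<otimes> \<one>)) = int (len \<one>) - int (len (f \<one>))"
    using assms by (auto simp: compulsive_def right_weak_le_def)
  then have "len (f \<one>) = 0" by simp
  then show ?thesis by (rule len_eq_0[OF f1])
qed

lemma compulsive_orbit_le:
  assumes fin: "finite (carrier W)" and irr: "coxeter_irreducible S m"
    and f: "compulsive W S f" and c: "coxeter_element W S c" and w: "w \<in> carrier W"
  shows "ecard (forward_orbit f w) \<le> enat (ord c)"
proof -
  obtain xs where xs: "distinct xs" "set xs = S" "c = word_prod W xs"
    using c by (auto simp: coxeter_element_def)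
  then have lists: "xs \<in> lists S" by auto
  then have cc: "c \<in> carrier W" using xs by simp
  define h where "h = ord c"
  have "0 < h" using ord_ge_1[OF fin cc] by (simp add: h_def)
  \<comment> \<open>The identity is fixed by \<open>f\<close>, so reaching it in
    \<open>h - 1\<close> steps leaves at most \<open>h\<close> elements in the orbit.\<close>
  have "(f ^^ (h - 1)) w = \<one>"
  \<comment> \<open>In rank 0 there is no Perron vector, and the group is trivial.\<close>
  proof (cases "S = {}")
    case True
    obtain ys where "ys \<in> lists S" "word_prod W ys = w" using ex_word[OF w] by auto
    then have "w = \<one>" using True by (cases ys) auto
    moreover have "(f ^^ k) \<one> = \<one>" for k
      using compulsive_one[OF f] by (induction k) auto
    ultimately show ?thesis by simp
  next
    case False
    have rep_c: "rep c = act xs"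
      using rep_word_prod[OF lists] xs(3) by simp
    have rep_pow: "rep (c [^] k) v = (act xs ^^ k) v" for k :: nat and v
    proof (induction k arbitrary: v)
      case (Suc k)
      have "rep (c [^] Suc k) v = rep (c [^] k) (rep c v)"
        using cc by (simp add: rep_mult)
      also have "\<dots> = (act xs ^^ Suc k) v"
        by (simp add: Suc.IH rep_c funpow_Suc_right del: funpow.simps)
      finally show ?case .
    qed simp
    have "(act xs ^^ h) v = v" for v
      using rep_pow[of h v] cc by (simp add: h_def)
    then obtain P M where P: "distinct P" "independent (set P)"
      and M: "distinct M" "independent (set M)"
      and S: "set P \<union> set M = S" "set P \<inter> set M = {}"
      and h: "\<And>v. (act (P @ M) ^^ h) v = v"
      using ex_bipartite[OF xs(1,2) _ finite_ex_leaf[OF fin]] by metis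
    have PS: "P \<in> lists S" and MS: "M \<in> lists S" using S by auto
    have "adjacent\<^sup>*\<^sup>* s t" if "s \<in> S" "t \<in> S" for s t
    proof -
      have "(s, t) \<in> (coxeter_diagram S m)\<^sup>*"
        using irr that by (simp add: coxeter_irreducible_def)
      then show ?thesis
      proof (induction rule: rtrancl_induct)
        case (step q r)
        then have "adjacent q r"
          using bond_eq_0_or_ge_1[of q r] by (auto simp: coxeter_diagram_def adjacent_def)
        then show ?case using step.IH by (rule rtranclp.rtrancl_into_rtrancl[rotated])
      qed simp
    qed
    then obtain y \<mu> where y: "\<And>s. s \<in> S \<Longrightarrow> 0 < y s"
      and eig: "\<And>s. s \<in> S \<Longrightarrow> (\<Sum>t\<in>S - {s}. bond m s t * y t) = \<mu> * y s"
      using ex_perron_vector[OF False] by metis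
    obtain s0 where s0: "s0 \<in> S" using False by auto
    have "0 \<le> (\<Sum>t\<in>S - {s0}. bond m s0 t * y t)"
      using a_nonneg[OF s0] y by (intro sum_nonneg mult_nonneg_nonneg) (auto simp: less_imp_le)
    then have "0 \<le> \<mu>" using eig[OF s0] y[OF s0] by (simp add: zero_le_mult_iff)
    \<comment> \<open>Otherwise the Perron vector itself would contradict
      \<open>finite_no_subharmonic\<close>. The bound makes the angle \<open>\<theta>\<close> below
      positive.\<close>
    have "\<mu> < 2"
    proof (rule ccontr)
      assume "\<not> \<mu> < 2"
      define v where "v r = (if r \<in> S then y r else 0)" for r
      have "2 * v s \<le> (\<Sum>t\<in>S - {s}. bond m s t * v t)" if s: "s \<in> S" for s
      proof -
        have "2 * y s \<le> \<mu> * y s" using \<open>\<not> \<mu> < 2\<close> y[OF s] by simp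
        moreover have "(\<Sum>t\<in>S - {s}. bond m s t * v t) = (\<Sum>t\<in>S - {s}. bond m s t * y t)"
          by (intro sum.cong) (auto simp: v_def)
        ultimately show ?thesis using eig[OF s] s by (simp add: v_def)
      qed
      then have "v = (\<lambda>r. 0)"
        using y by (intro finite_no_subharmonic[OF fin]) (auto simp: supported_def v_def less_imp_le)
      then show False using y[OF s0] s0 by (auto simp: v_def fun_eq_iff split: if_splits)
    qed
    define \<theta> where "\<theta> = arccos (\<mu> / 2)"
    have "2 * cos \<theta> = \<mu>" using \<open>0 \<le> \<mu>\<close> \<open>\<mu> < 2\<close> by (simp add: \<theta>_def cos_arccos)
    then have eig': "\<And>s. s \<in> S \<Longrightarrow> (\<Sum>t\<in>S - {s}. bond m s t * y t) = 2 * cos \<theta> * y s"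
      using eig by simp
    have "0 < \<theta>" "\<theta> \<le> pi / 2"
      using arccos_lt_bounded[of "\<mu> / 2"] arccos_le_pi2[of "\<mu> / 2"] \<open>0 \<le> \<mu>\<close> \<open>\<mu> < 2\<close>
      by (simp_all add: \<theta>_def)
    \<comment> \<open>The least integer with \<open>pi \<le> (k + 1 / 2) * \<theta>\<close>. It is
      below \<open>pi / \<theta> + 1 / 2\<close>, which is at most \<open>h + 1 / 2\<close>, so
      \<open>k \<le> h\<close>.\<close>
    define k where "k = nat \<lceil>pi / \<theta> - 1 / 2\<rceil>"
    have "1 \<le> pi / \<theta>" using \<open>0 < \<theta>\<close> \<open>\<theta> \<le> pi / 2\<close> by (simp add: field_simps)
    then have k: "pi / \<theta> - 1 / 2 \<le> real k" "real k < pi / \<theta> + 1 / 2"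
      unfolding k_def by linarith+
    then have k': "pi \<le> (real k + 1 / 2) * \<theta>" "(real k - 1 / 2) * \<theta> \<le> pi"
      using \<open>0 < \<theta>\<close> by (simp_all add: field_simps)
    have "pi \<le> real h * \<theta>"
      by (rule pi_le_order_mult_angle[OF P M S False y eig' \<open>0 < \<theta>\<close> \<open>\<theta> \<le> pi / 2\<close> \<open>0 < h\<close> h])
    then have "pi / \<theta> \<le> real h" using \<open>0 < \<theta>\<close> by (simp add: field_simps)
    then have "k \<le> h" using k by linarith
    have reach: "(f ^^ (h - 1)) w \<in> subwords A"
      if A: "distinct A" "independent (set A)" and B: "distinct B" "independent (set B)"
        and AB: "set A \<union> set B = S" "set A \<inter> set B = {}" for A B
    proof -
      have AS: "A \<in> lists S" and BS: "B \<in> lists S" using AB by auto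
      have "subwords (blocks k A B) = carrier W"
        using blocks_all_descents[OF A B AB y eig' \<open>0 < \<theta>\<close> \<open>\<theta> \<le> pi / 2\<close> k']
        by (intro subwords_eq_carrier fin blocks_in_lists AS BS) auto
      moreover obtain zs where "blocks h A B = blocks k A B @ zs"
        using blocks_add[of k "h - k" A B] \<open>k \<le> h\<close> by auto
      \<comment> \<open>The word is lengthened from \<open>k\<close> to \<open>h\<close> factors, of
        which \<open>h - 1\<close> are stripped and the first, \<open>A\<close>, remains.\<close>
      ultimately have "w \<in> subwords (blocks ((h - 1) + 1) A B)"
        using w subwords_prefix[of "blocks k A B" zs] \<open>0 < h\<close> by auto
      then have "(f ^^ (h - 1)) w \<in> subwords (blocks 1 A B)"
        by (rule compulsive_iterate[OF f AS A BS B])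
      then show ?thesis by simp
    qed
    show ?thesis
      using reach[OF P M S] reach[OF M P] S by (intro subwords_disjoint[OF PS MS S(2)]) auto
  qed
  then show ?thesis
    using ecard_forward_orbit_le[of "h - 1" f w \<one>] compulsive_one[OF f] \<open>0 < h\<close>
    by (simp add: h_def)
qed

end

theorem theorem1p5:
  fixes W :: "('a, 'b) monoid_scheme" and S :: "'a set"
    and m :: "'a \<Rightarrow> 'a \<Rightarrow> enat" and h :: enat and f :: "'a \<Rightarrow> 'a"
  assumes "coxeter_system W S m"
    and "coxeter_irreducible S m"
    and "is_coxeter_number W S h"
    and "compulsive W S f"
  shows "(SUP w \<in> carrier W. ecard (forward_orbit f w)) \<le> h"
proof (cases "finite (carrier W)")
  case True
  have "S \<subseteq> carrier W"
    using assms(1) by (simp add: coxeter_system_def has_presentation_def)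
  then interpret finite_rank_coxeter W S m
    using assms(1) True by unfold_locales (auto intro: finite_subset)
  obtain c where "coxeter_element W S c" "h = enat (group.ord W c)"
    using assms(3) True by (auto simp: is_coxeter_number_def)
  then show ?thesis
    using compulsive_orbit_le[OF True assms(2,4)] by (auto intro!: SUP_least)
next
  case False
  then show ?thesis using assms(3) by (simp add: is_coxeter_number_def)
qed

end
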